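(* Let $\alpha$ be the shift on the full group $C^*$-algebra $C^*(\mathbb F_\infty)$ of the free group on countably infinitely many generators, and let $T_\alpha$ be the homeomorphism $\sigma\mapsto\sigma\circ\alpha$ of the state space $S(C^*(\mathbb F_\infty))$ with the weak$^*$ topology. Then $h_{\mathrm{top}}(T_\alpha)=\infty$.
   Context: The generators of $\mathbb F_\infty$ are indexed by $\mathbb Z$, and $\{u_i\}_{i\in\mathbb Z}$ are the corresponding canonical unitaries in $C^*(\mathbb F_\infty)$; the shift $\alpha$ is the automorphism determined by $\alpha(u_i)=u_{i+1}$ for all $i\in\mathbb Z$. For a unital $C^*$-algebra $A$, $S(A)$ is the set of positive linear functionals $\phi$ on $A$ with $\phi(1)=1$. Topological entropy: for a homeomorphism $T$ of a compact metrizable space $X$ and a finite open cover $\mathcal U$ of $X$, let $N(\mathcal U)$ be the smallest cardinality of a subcover, $h_{\mathrm{top}}(T,\mathcal U)=\lim_{n\to\infty}\frac1n\log N(\mathcal U\vee T^{-1}\mathcal U\vee\cdots\vee T^{-(n-1)}\mathcal U)$, and $h_{\mathrm{top}}(T)=\sup_{\mathcal U}h_{\mathrm{top}}(T,\mathcal U)$ over all finite open covers. *)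

theory Defs
  imports "HOL-Analysis.Analysis" "HOL-Library.Poly_Mapping"
begin

section \<open>Unital C*-algebras\<close>

class scaleC =
  fixes scaleC :: "complex \<Rightarrow> 'a \<Rightarrow> 'a"  (infixr \<open>*\<^sub>C\<close> 75)

class star =
  fixes star :: "'a \<Rightarrow> 'a"

text \<open>
  The axiom \<open>norm 1 = 1\<close> of \<^class>\<open>real_normed_algebra_1\<close> excludes only the zero algebra.
\<close>

class cstar_algebra = banach + real_normed_algebra_1 + scaleC + star +
  assumes scaleC_add_right: "c *\<^sub>C (x + y) = c *\<^sub>C x + c *\<^sub>C y"
    and scaleC_add_left: "(c + d) *\<^sub>C x = c *\<^sub>C x + d *\<^sub>C x"
    and scaleC_scaleC: "c *\<^sub>C d *\<^sub>C x = (c * d) *\<^sub>C x"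
    and scaleR_scaleC: "r *\<^sub>R x = complex_of_real r *\<^sub>C x"
    and mult_scaleC_left: "(c *\<^sub>C x) * y = c *\<^sub>C (x * y)"
    and mult_scaleC_right: "x * (c *\<^sub>C y) = c *\<^sub>C (x * y)"
    and norm_scaleC: "norm (c *\<^sub>C x) = cmod c * norm x"
    and star_add: "star (x + y) = star x + star y"
    and star_scaleC: "star (c *\<^sub>C x) = cnj c *\<^sub>C star x"
    and star_mult: "star (x * y) = star y * star x"
    and star_star: "star (star x) = x"
    and cstar_identity: "norm (star x * x) = (norm x)\<^sup>2"

instantiation complex :: cstar_algebra
begin

definition scaleC_complex :: "complex \<Rightarrow> complex \<Rightarrow> complex"
  where "scaleC_complex = (*)"

definition star_complex :: "complex \<Rightarrow> complex"
  where "star_complex = cnj"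

instance
  by standard
    (simp_all add: scaleC_complex_def star_complex_def algebra_simps norm_mult
      scaleR_conv_of_real power2_eq_square)

end

definition star_hom :: "('a::cstar_algebra \<Rightarrow> 'b::cstar_algebra) \<Rightarrow> bool"
  where "star_hom h \<longleftrightarrow>
    (\<forall>x y. h (x + y) = h x + h y) \<and> (\<forall>c x. h (c *\<^sub>C x) = c *\<^sub>C h x) \<and>
    (\<forall>x y. h (x * y) = h x * h y) \<and> h 1 = 1 \<and> (\<forall>x. h (star x) = star (h x))"

definition star_automorphism :: "('a::cstar_algebra \<Rightarrow> 'a) \<Rightarrow> bool"
  where "star_automorphism h \<longleftrightarrow> star_hom h \<and> bij h"

definition unitary :: "'a::cstar_algebra \<Rightarrow> bool"
  where "unitary v \<longleftrightarrow> star v * v = 1 \<and> v * star v = 1"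

definition state_space :: "('a::cstar_algebra \<Rightarrow> complex) set"
  where "state_space = {\<phi>. (\<forall>x y. \<phi> (x + y) = \<phi> x + \<phi> y) \<and> (\<forall>c x. \<phi> (c *\<^sub>C x) = c * \<phi> x) \<and>
    (\<forall>x. \<phi> (star x * x) \<in> \<real>\<^sub>\<ge>\<^sub>0) \<and> \<phi> 1 = 1}"

text \<open>The weak* topology is the topology of pointwise convergence, i.e. the subspace topology
  inherited from the product topology on all functions.\<close>

definition weak_star_state_space :: "('a::cstar_algebra \<Rightarrow> complex) topology"
  where "weak_star_state_space =
    subtopology (product_topology (\<lambda>_. euclidean) UNIV) state_space"


subsection \<open>Star-homomorphisms are contractive\<close>

context
  fixes x :: "'a::cstar_algebra"
begin

lemma scaleC_one [simp]: "1 *\<^sub>C x = x"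
  using scaleR_scaleC[of 1 x] by simp

lemma scaleC_zero_left [simp]: "0 *\<^sub>C x = 0"
  using scaleR_scaleC[of 0 x] by simp

lemma scaleC_zero_right [simp]: "c *\<^sub>C (0::'a) = 0"
  using norm_scaleC[of c "0::'a"] by simp

lemma scaleC_minus_one: "(-1) *\<^sub>C x = - x"
  using scaleR_scaleC[of "-1" x] by simp

lemma scaleC_minus_left: "(- c) *\<^sub>C x = - (c *\<^sub>C x)"
  using scaleC_add_left[of c "-c" x] by (simp add: eq_neg_iff_add_eq_0 add.commute)

lemma star_zero [simp]: "star (0::'a) = 0"
  using star_add[of "0::'a" 0] by simp

lemma star_one [simp]: "star (1::'a) = 1"
  by (metis mult_1 mult_1_right star_mult star_star)

lemma star_minus: "star (- x) = - star x"
  using star_add[of x "-x"] by (simp add: eq_neg_iff_add_eq_0 add.commute)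

lemma norm_star [simp]: "norm (star x) = norm x"
proof -
  have le: "norm y \<le> norm (star y)" for y :: 'a
  proof (cases "y = 0")
    case False
    have "norm y * norm y \<le> norm (star y) * norm y"
      using norm_mult_ineq[of "star y" y] by (simp add: cstar_identity power2_eq_square)
    with False show ?thesis by simp
  qed simp
  show ?thesis using le[of x] le[of "star x"] by (simp add: star_star)
qed

end

lemma scaleC_minus_right: "c *\<^sub>C (- x) = - (c *\<^sub>C (x::'a::cstar_algebra))"
  using scaleC_add_right[of c x "-x"] by (simp add: eq_neg_iff_add_eq_0 add.commute)

lemma scaleC_diff_right: "c *\<^sub>C (x - y) = c *\<^sub>C x - c *\<^sub>C (y::'a::cstar_algebra)"
  using scaleC_add_right[of c x "-y"] by (simp add: scaleC_minus_right)

lemma star_diff: "star (x - y) = star x - star (y::'a::cstar_algebra)"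
  using star_add[of x "-y"] by (simp add: star_minus)

lemma bounded_linear_star: "bounded_linear (star :: 'a::cstar_algebra \<Rightarrow> 'a)"
  by (rule bounded_linear_intro[where K = 1]) (simp_all add: star_add scaleR_scaleC star_scaleC)

lemma star_power: "star (x ^ n) = star (x::'a::cstar_algebra) ^ n"
  by (induction n) (simp_all add: star_mult power_commutes)

lemma abs_gbinomial_half_le: "\<bar>(1/2 :: real) gchoose n\<bar> \<le> 1"
proof (induction n)
  case (Suc n)
  have "of_nat (Suc n) * ((1/2 :: real) gchoose (Suc n)) = (1/2 - real n) * ((1/2) gchoose n)"
    using gbinomial_mult_1[of "1/2::real" n] by (simp add: algebra_simps)
  then have "real (Suc n) * \<bar>(1/2 :: real) gchoose (Suc n)\<bar> = \<bar>1/2 - real n\<bar> * \<bar>(1/2) gchoose n\<bar>"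
    by (metis abs_mult abs_of_nat)
  also have "\<dots> \<le> real (Suc n) * 1"
    by (rule mult_mono) (use Suc in auto)
  finally show ?case
    by (metis mult_le_cancel_left_pos of_nat_0_less_iff zero_less_Suc)
qed simp

lemma exists_sqrt_one_plus:
  fixes b :: "'a::cstar_algebra"
  assumes "norm b < 1" "star b = b"
  obtains c where "c * c = 1 + b" "star c = c" "\<And>a. a * b = b * a \<Longrightarrow> a * c = c * a"
proof -
  define g where "g n = ((1/2::real) gchoose n)" for n
  define f where "f n = g n *\<^sub>R b ^ n" for n
  have sn: "summable (\<lambda>n. norm (f n))"
  proof (rule summable_comparison_test')
    show "summable (\<lambda>n. norm b ^ n)"
      using assms by (intro summable_geometric) simp
    show "norm (norm (f n)) \<le> norm b ^ n" if "n \<ge> 0" for n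
    proof -
      have "\<bar>g n\<bar> * norm (b ^ n) \<le> 1 * norm b ^ n"
        by (rule mult_mono) (auto simp: g_def abs_gbinomial_half_le norm_power_ineq)
      then show ?thesis by (simp add: f_def)
    qed
  qed
  have s: "summable f" using sn by (rule summable_norm_cancel)
  define c where "c = suminf f"
  have "(\<lambda>k. \<Sum>i\<le>k. f i * f (k - i)) sums (c * c)"
    unfolding c_def by (rule Cauchy_product_sums[OF sn sn])
  moreover have "(\<Sum>i\<le>k. f i * f (k - i)) = ((1::real) gchoose k) *\<^sub>R b ^ k" for k
  proof -
    have "(\<Sum>i\<le>k. f i * f (k - i)) = (\<Sum>i\<le>k. (g i * g (k - i)) *\<^sub>R b ^ k)"
      by (rule sum.cong) (simp_all add: f_def flip: power_add)
    also have "\<dots> = (\<Sum>i=0..k. g i * g (k - i)) *\<^sub>R b ^ k"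
      by (simp add: scaleR_sum_left atLeast0AtMost)
    also have "(\<Sum>i=0..k. g i * g (k - i)) = ((1/2 + 1/2 :: real) gchoose k)"
      unfolding g_def by (rule gbinomial_Vandermonde)
    finally show ?thesis by simp
  qed
  ultimately have "(\<lambda>k. ((1::real) gchoose k) *\<^sub>R b ^ k) sums (c * c)" by simp
  moreover have "(\<lambda>k. ((1::real) gchoose k) *\<^sub>R b ^ k) sums (\<Sum>k\<in>{0,1}. ((1::real) gchoose k) *\<^sub>R b ^ k)"
  proof (rule sums_finite)
    fix k :: nat assume k: "k \<notin> {0,1}"
    have "((1::real) gchoose k) = of_nat (1 choose k)"
      using binomial_gbinomial[of 1 k, where ?'a = real] by simp
    also have "1 choose k = 0" using k by (intro binomial_eq_0) auto
    finally show "((1::real) gchoose k) *\<^sub>R b ^ k = 0" by simp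
  qed simp
  ultimately have "c * c = (\<Sum>k\<in>{0,1}. ((1::real) gchoose k) *\<^sub>R b ^ k)"
    by (rule sums_unique2)
  then have 1: "c * c = 1 + b" by simp
  have "star c = suminf (\<lambda>n. star (f n))"
    unfolding c_def using bounded_linear.suminf[OF bounded_linear_star s] by simp
  also have "(\<lambda>n. star (f n)) = f"
    by (auto simp: f_def scaleR_scaleC star_scaleC star_power assms)
  finally have 2: "star c = c" by (simp add: c_def)
  have 3: "a * c = c * a" if "a * b = b * a" for a
  proof -
    have "a * b ^ n = b ^ n * a" for n
      by (metis power_commuting_commutes that)
    then have "a * f n = f n * a" for n by (simp add: f_def)
    then show ?thesis
      unfolding c_def using suminf_mult[OF s, of a] suminf_mult2[OF s, of a] by simp
  qed
  show ?thesis using that 1 2 3 by blast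
qed

lemma selfadjoint_isometry_decomp:
  fixes a :: "'a::cstar_algebra"
  assumes "norm a < 1" "star a = a"
  obtains d where "star d * d = 1" "a = (1/2) *\<^sub>C (d + star d)"
proof -
  have "norm (- (a * a)) < 1"
    using cstar_identity[of a] assms by (simp add: abs_square_less_1)
  moreover have "star (- (a * a)) = - (a * a)"
    by (simp add: star_minus star_mult assms)
  ultimately obtain c where c: "c * c = 1 + - (a * a)" "star c = c"
    "\<And>e. e * - (a * a) = - (a * a) * e \<Longrightarrow> e * c = c * e"
    by (rule exists_sqrt_one_plus[of "- (a * a)"]) blast+
  have ac: "a * c = c * a" by (rule c(3)) (simp add: mult.assoc)
  define d where "d = a + \<i> *\<^sub>C c"
  have sd: "star d = a - \<i> *\<^sub>C c"
    by (simp add: d_def star_add star_scaleC assms c scaleC_minus_left)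
  have "star d * d = (a - \<i> *\<^sub>C c) * (a + \<i> *\<^sub>C c)"
    unfolding sd by (simp add: d_def)
  also have "\<dots> = a * a + c * c"
    by (simp add: algebra_simps mult_scaleC_left mult_scaleC_right scaleC_scaleC ac
        scaleC_diff_right scaleC_minus_one)
  finally have 1: "star d * d = 1" by (simp add: c)
  have "d + star d = a + a" unfolding sd by (simp add: d_def)
  then have "(1/2) *\<^sub>C (d + star d) = (1/2 + 1/2) *\<^sub>C a"
    by (simp only: scaleC_add_right scaleC_add_left)
  then have 2: "a = (1/2) *\<^sub>C (d + star d)" by simp
  show ?thesis using that 1 2 by blast
qed

lemma star_hom_contractive:
  fixes h :: "'a::cstar_algebra \<Rightarrow> 'b::cstar_algebra"
  assumes "star_hom h"
  shows "norm (h x) \<le> norm x"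
proof -
  have add: "h (x + y) = h x + h y" and sc: "h (c *\<^sub>C x) = c *\<^sub>C h x"
    and mult: "h (x * y) = h x * h y" and one: "h 1 = 1" and st: "h (star x) = star (h x)" for x y c
    using assms unfolding star_hom_def by blast+
  have sa1: "norm (h a) \<le> 1" if a: "norm a < 1" "star a = a" for a
  proof -
    obtain d where d: "star d * d = 1" "a = (1/2) *\<^sub>C (d + star d)"
      by (rule selfadjoint_isometry_decomp[OF a])
    have "star (h d) * h d = 1" using d(1) one by (metis mult st)
    then have nd: "norm (h d) = 1"
      using cstar_identity[of "h d"] by (simp add: power2_eq_1_iff) (smt (verit) norm_ge_zero)
    have "norm (h a) = 1/2 * norm (h d + star (h d))"
      by (simp add: d(2) sc add st norm_scaleC norm_divide)
    also have "\<dots> \<le> 1/2 * (norm (h d) + norm (star (h d)))"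
      by (intro mult_left_mono norm_triangle_ineq) simp
    finally show ?thesis by (simp add: nd)
  qed
  have sa: "norm (h a) \<le> norm a" if a: "star a = a" for a
  proof (rule field_le_epsilon)
    fix e :: real assume e: "e > 0"
    define r where "r = norm a + e"
    have r: "r > 0" using e by (simp add: r_def add_nonneg_pos)
    let ?b = "complex_of_real (1/r) *\<^sub>C a"
    have "norm ?b = norm a / r" using r by (simp add: norm_scaleC norm_divide)
    also have "\<dots> < 1" using r e by (simp add: r_def)
    finally have "norm ?b < 1" .
    moreover have "star ?b = ?b" by (simp add: star_scaleC a)
    ultimately have "norm (h ?b) \<le> 1" by (rule sa1)
    moreover have "norm (h ?b) = norm (h a) / r"
      using r by (simp add: sc norm_scaleC norm_divide)
    ultimately show "norm (h a) \<le> norm a + e"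
      using r by (simp add: r_def)
  qed
  have "(norm (h x))\<^sup>2 = norm (h (star x * x))"
    by (simp add: mult st cstar_identity)
  also have "\<dots> \<le> norm (star x * x)"
    by (rule sa) (simp add: star_mult star_star)
  also have "\<dots> = (norm x)\<^sup>2" by (rule cstar_identity)
  finally show ?thesis by (rule power2_le_imp_le) simp
qed


section \<open>Full group C*-algebras\<close>

subsection \<open>The group algebra and its largest C*-seminorm\<close>

text \<open>
  Groups are written additively (\<^class>\<open>group_add\<close> is not commutative), so that the convolution
  product of \<^theory>\<open>HOL-Library.Poly_Mapping\<close> makes \<open>'g \<Rightarrow>\<^sub>0 complex\<close> the complex group algebra,
  with the group element \<open>g\<close> embedded as \<open>single g 1\<close> and scalars as \<open>single 0 c\<close>.
\<close>

lift_definition group_alg_star :: "('g::group_add \<Rightarrow>\<^sub>0 complex) \<Rightarrow> ('g \<Rightarrow>\<^sub>0 complex)"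
  is "\<lambda>f g. cnj (f (- g))"
proof -
  fix f :: "'g \<Rightarrow> complex" assume "finite {x. f x \<noteq> 0}"
  then have "finite (uminus ` {x. f x \<noteq> 0})" by simp
  then show "finite {x. cnj (f (- x)) \<noteq> 0}"
    by (rule rev_finite_subset) (auto intro: image_eqI[where x = "- _"])
qed

definition cstar_seminorm :: "(('g::group_add \<Rightarrow>\<^sub>0 complex) \<Rightarrow> real) \<Rightarrow> bool"
  where "cstar_seminorm p \<longleftrightarrow>
    (\<forall>f. 0 \<le> p f) \<and> (\<forall>f h. p (f + h) \<le> p f + p h) \<and>
    (\<forall>c f. p (Poly_Mapping.single 0 c * f) = cmod c * p f) \<and>
    (\<forall>f h. p (f * h) \<le> p f * p h) \<and> (\<forall>f. p (group_alg_star f * f) = (p f)\<^sup>2)"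

text \<open>
  By the GNS construction the C*-seminorms on the group algebra are exactly the maps
  \<open>f \<mapsto> \<parallel>\<pi> f\<parallel>\<close> with \<open>\<pi>\<close> a star-representation on a Hilbert space, so the following is the usual
  supremum over all unitary representations of the group, without a quantification over types.
\<close>

definition full_norm :: "('g::group_add \<Rightarrow>\<^sub>0 complex) \<Rightarrow> real"
  where "full_norm f = Sup {p f | p. cstar_seminorm p}"

lemma group_alg_induct [case_names single add]:
  fixes f :: "'g::group_add \<Rightarrow>\<^sub>0 complex"
  assumes "\<And>g c. P (Poly_Mapping.single g c)" "\<And>f h. P f \<Longrightarrow> P h \<Longrightarrow> P (f + h)"
  shows "P f"
proof (induction f rule: Poly_Mapping.update_induct)
  case const
  show ?case using assms(1)[of 0 0] by simp
next
  case (update f a b)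
  have "Poly_Mapping.update a b f = f + Poly_Mapping.single a b"
    using update(1) by (intro poly_mapping_eqI)
      (auto simp: Poly_Mapping.lookup_update lookup_add lookup_single when_def in_keys_iff)
  then show ?case using assms update by simp
qed

lemma group_alg_star_single [simp]:
  "group_alg_star (Poly_Mapping.single g c) = Poly_Mapping.single (- g) (cnj c)"
  by (rule poly_mapping_eqI)
    (auto simp: group_alg_star.rep_eq lookup_single when_def)

lemma group_alg_star_add: "group_alg_star (f + h) = group_alg_star f + group_alg_star h"
  by (rule poly_mapping_eqI) (simp add: group_alg_star.rep_eq lookup_add)

lemma group_alg_star_diff: "group_alg_star (f - h) = group_alg_star f - group_alg_star h"
  by (rule poly_mapping_eqI) (simp add: group_alg_star.rep_eq lookup_minus)

lemma group_alg_star_star [simp]: "group_alg_star (group_alg_star f) = f"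
  by (rule poly_mapping_eqI) (simp add: group_alg_star.rep_eq)

lemma group_alg_star_one [simp]: "group_alg_star 1 = 1"
  using group_alg_star_single[of 0 1] by simp

lemma group_alg_star_mult: "group_alg_star (f * h) = group_alg_star h * group_alg_star f"
proof (induction f rule: group_alg_induct)
  case (single g c)
  show ?case
  proof (induction h rule: group_alg_induct)
    case (single g' c')
    show ?case by (simp add: mult_single minus_add mult.commute)
  next
    case (add f h)
    then show ?case by (simp add: distrib_left distrib_right group_alg_star_add)
  qed
next
  case (add f h')
  then show ?case by (simp add: distrib_left distrib_right group_alg_star_add)
qed

lemma single_zero_commute:
  fixes f :: "'g::group_add \<Rightarrow>\<^sub>0 complex"
  shows "f * Poly_Mapping.single 0 (c::complex) = Poly_Mapping.single 0 c * f"
  by (induction f rule: group_alg_induct) (simp_all add: mult_single mult.commute distrib_left distrib_right)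

definition group_alg_lift :: "('g::group_add \<Rightarrow> 'b::cstar_algebra) \<Rightarrow> ('g \<Rightarrow>\<^sub>0 complex) \<Rightarrow> 'b"
  where "group_alg_lift U f = (\<Sum>g\<in>Poly_Mapping.keys f. Poly_Mapping.lookup f g *\<^sub>C U g)"

definition unitary_rep :: "('g::group_add \<Rightarrow> 'b::cstar_algebra) \<Rightarrow> bool"
  where "unitary_rep U \<longleftrightarrow> (\<forall>g. unitary (U g)) \<and> (\<forall>g h. U (g + h) = U g * U h)"

lemma unitary_rep_zero:
  assumes "unitary_rep U" shows "U 0 = 1"
proof -
  have "U 0 * U 0 = U 0" and u: "star (U 0) * U 0 = 1"
    using assms unfolding unitary_rep_def unitary_def by (metis add_0, metis)
  then have "star (U 0) * (U 0 * U 0) = 1" by simp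
  then show ?thesis by (simp add: u flip: mult.assoc)
qed

lemma unitary_rep_minus:
  assumes "unitary_rep U" shows "U (- g) = star (U g)"
proof -
  have "U (- g) * U g = 1" "U g * star (U g) = 1"
    using assms unitary_rep_zero[OF assms] unfolding unitary_rep_def unitary_def
    by (metis left_minus, metis)
  then show ?thesis by (metis mult.assoc mult_1 mult_1_right)
qed

lemma group_alg_lift_superset:
  assumes "finite S" "Poly_Mapping.keys f \<subseteq> S"
  shows "group_alg_lift U f = (\<Sum>g\<in>S. Poly_Mapping.lookup f g *\<^sub>C U g)"
  unfolding group_alg_lift_def
  by (rule sum.mono_neutral_left) (use assms in \<open>auto simp: in_keys_iff\<close>)

lemma group_alg_lift_add: "group_alg_lift U (f + h) = group_alg_lift U f + group_alg_lift U h"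
proof -
  let ?S = "Poly_Mapping.keys f \<union> Poly_Mapping.keys h"
  have "group_alg_lift U k = (\<Sum>g\<in>?S. Poly_Mapping.lookup k g *\<^sub>C U g)"
    if "k \<in> {f, h, f + h}" for k
    using that Poly_Mapping.keys_add[of f h] by (intro group_alg_lift_superset) auto
  then show ?thesis by (simp add: lookup_add scaleC_add_left sum.distrib)
qed

lemma group_alg_lift_single: "group_alg_lift U (Poly_Mapping.single g c) = c *\<^sub>C U g"
  by (subst group_alg_lift_superset[where S = "{g}"]) (auto simp: lookup_single)

lemma group_alg_lift_mult:
  assumes "unitary_rep U"
  shows "group_alg_lift U (f * h) = group_alg_lift U f * group_alg_lift U h"
proof (induction f rule: group_alg_induct)
  case (single g c)
  show ?case
  proof (induction h rule: group_alg_induct)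
    case (single g' c')
    show ?case using assms
      by (simp add: mult_single group_alg_lift_single mult_scaleC_left mult_scaleC_right
          scaleC_scaleC unitary_rep_def mult.commute)
  next
    case (add f h)
    then show ?case by (simp add: distrib_left distrib_right group_alg_lift_add)
  qed
next
  case (add f h')
  then show ?case by (simp add: distrib_left distrib_right group_alg_lift_add)
qed

lemma group_alg_lift_star:
  assumes "unitary_rep U"
  shows "group_alg_lift U (group_alg_star f) = star (group_alg_lift U f)"
  by (induction f rule: group_alg_induct)
    (simp_all add: group_alg_lift_single group_alg_star_add group_alg_lift_add star_add star_scaleC
      unitary_rep_minus[OF assms])

lemma cstar_seminorm_group_alg_lift:
  assumes "unitary_rep U"
  shows "cstar_seminorm (\<lambda>f. norm (group_alg_lift U f))"
  unfolding cstar_seminorm_def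
  by (auto simp: group_alg_lift_add norm_triangle_ineq group_alg_lift_mult[OF assms] norm_mult_ineq
      group_alg_lift_star[OF assms] cstar_identity group_alg_lift_single unitary_rep_zero[OF assms]
      mult_scaleC_left norm_scaleC)

lemma cstar_seminorm_bounded:
  fixes f :: "'g::group_add \<Rightarrow>\<^sub>0 complex"
  shows "\<exists>B. \<forall>p. cstar_seminorm p \<longrightarrow> p f \<le> B"
proof (induction f rule: group_alg_induct)
  case (single g c)
  have "p (Poly_Mapping.single g c) \<le> cmod c" if p: "cstar_seminorm p"
    for p :: "('g \<Rightarrow>\<^sub>0 complex) \<Rightarrow> real"
  proof -
    have sq: "p (group_alg_star f * f) = (p f)\<^sup>2" and nn: "0 \<le> p f"
      and sc: "p (Poly_Mapping.single 0 c * f) = cmod c * p f" for f c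
      using p unfolding cstar_seminorm_def by auto
    have one: "p 1 = (p 1)\<^sup>2"
      using sq[of 1] by simp
    have "p 1 \<le> 1"
    proof (rule ccontr)
      assume "\<not> p 1 \<le> 1"
      then have "p 1 * 1 < p 1 * p 1" by (intro mult_strict_left_mono) auto
      then show False using one unfolding power2_eq_square by linarith
    qed
    moreover have "(p (Poly_Mapping.single g 1))\<^sup>2 = p 1"
      using sq[of "Poly_Mapping.single g 1"] by (simp add: mult_single)
    ultimately have "p (Poly_Mapping.single g 1) \<le> 1"
      by (metis abs_le_square_iff abs_of_nonneg nn one_power2 abs_one)
    then have "cmod c * p (Poly_Mapping.single g 1) \<le> cmod c * 1"
      by (intro mult_left_mono) auto
    then show ?thesis
      using sc[of c "Poly_Mapping.single g 1"] by (simp add: mult_single)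
  qed
  then show ?case by blast
next
  case (add f h)
  then obtain B C where "\<forall>p. cstar_seminorm p \<longrightarrow> p f \<le> B" "\<forall>p. cstar_seminorm p \<longrightarrow> p h \<le> C"
    by blast
  then have "\<forall>p. cstar_seminorm p \<longrightarrow> p (f + h) \<le> B + C"
    unfolding cstar_seminorm_def by (smt (verit))
  then show ?case by blast
qed

lemma cstar_seminorm_le_full_norm:
  assumes "cstar_seminorm p" shows "p f \<le> full_norm f"
  unfolding full_norm_def
proof (rule cSup_upper)
  show "p f \<in> {p f | p. cstar_seminorm p}" using assms by blast
  show "bdd_above {p f | p. cstar_seminorm p}"
    using cstar_seminorm_bounded[of f] by (auto simp: bdd_above_def)
qed

lemma unitary_rep_trivial: "unitary_rep (\<lambda>_. 1)"
  by (simp add: unitary_rep_def unitary_def)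

lemma full_norm_le:
  assumes "\<And>p. cstar_seminorm p \<Longrightarrow> p f \<le> B"
  shows "full_norm f \<le> B"
  unfolding full_norm_def
proof (rule cSup_least)
  show "{p f | p. cstar_seminorm p} \<noteq> {}"
    using cstar_seminorm_group_alg_lift[OF unitary_rep_trivial[where 'b = complex]] by blast
qed (use assms in blast)

lemma full_norm_nonneg: "0 \<le> full_norm f"
  by (rule order_trans[OF _ cstar_seminorm_le_full_norm[OF
        cstar_seminorm_group_alg_lift[OF unitary_rep_trivial[where 'b = complex]]]]) simp

lemma cstar_seminorm_full_norm: "cstar_seminorm (full_norm :: ('g::group_add \<Rightarrow>\<^sub>0 complex) \<Rightarrow> real)"
proof -
  note up = cstar_seminorm_le_full_norm
  have add: "full_norm (f + h) \<le> full_norm f + full_norm h" for f h :: "'g \<Rightarrow>\<^sub>0 complex"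
  proof (rule full_norm_le)
    fix p :: "('g \<Rightarrow>\<^sub>0 complex) \<Rightarrow> real" assume p: "cstar_seminorm p"
    then have "p (f + h) \<le> p f + p h" by (simp add: cstar_seminorm_def)
    with up[OF p, of f] up[OF p, of h] show "p (f + h) \<le> full_norm f + full_norm h" by linarith
  qed
  have mult: "full_norm (f * h) \<le> full_norm f * full_norm h" for f h :: "'g \<Rightarrow>\<^sub>0 complex"
  proof (rule full_norm_le)
    fix p :: "('g \<Rightarrow>\<^sub>0 complex) \<Rightarrow> real" assume p: "cstar_seminorm p"
    then have "p (f * h) \<le> p f * p h" "0 \<le> p h" by (simp_all add: cstar_seminorm_def)
    moreover have "p f * p h \<le> full_norm f * full_norm h"
      using up[OF p] p by (intro mult_mono) (auto simp: full_norm_nonneg cstar_seminorm_def)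
    ultimately show "p (f * h) \<le> full_norm f * full_norm h" by linarith
  qed
  have sc_le: "full_norm (Poly_Mapping.single 0 c * f) \<le> cmod c * full_norm f"
    for c and f :: "'g \<Rightarrow>\<^sub>0 complex"
  proof (rule full_norm_le)
    fix p :: "('g \<Rightarrow>\<^sub>0 complex) \<Rightarrow> real" assume p: "cstar_seminorm p"
    then have "p (Poly_Mapping.single 0 c * f) = cmod c * p f" by (simp add: cstar_seminorm_def)
    with up[OF p, of f] show "p (Poly_Mapping.single 0 c * f) \<le> cmod c * full_norm f"
      by (simp add: mult_left_mono)
  qed
  have sc: "full_norm (Poly_Mapping.single 0 c * f) = cmod c * full_norm f"
    for c and f :: "'g \<Rightarrow>\<^sub>0 complex"
  proof (cases "c = 0")
    case True
    then show ?thesis using sc_le[of 0 f] full_norm_nonneg[of "Poly_Mapping.single 0 c * f"] by simp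
  next
    case False
    have "full_norm f = full_norm (Poly_Mapping.single 0 (inverse c) * (Poly_Mapping.single 0 c * f))"
      using False by (simp add: mult_single flip: mult.assoc)
    also have "\<dots> \<le> cmod (inverse c) * full_norm (Poly_Mapping.single 0 c * f)" by (rule sc_le)
    finally show ?thesis using False sc_le[of c f] by (simp add: norm_divide field_simps)
  qed
  have sq: "full_norm (group_alg_star f * f) = (full_norm f)\<^sup>2" for f :: "'g \<Rightarrow>\<^sub>0 complex"
  proof (rule antisym)
    show "full_norm (group_alg_star f * f) \<le> (full_norm f)\<^sup>2"
    proof (rule full_norm_le)
      fix p :: "('g \<Rightarrow>\<^sub>0 complex) \<Rightarrow> real" assume p: "cstar_seminorm p"
      then have "p (group_alg_star f * f) = (p f)\<^sup>2" "0 \<le> p f" by (simp_all add: cstar_seminorm_def)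
      with up[OF p, of f] show "p (group_alg_star f * f) \<le> (full_norm f)\<^sup>2"
        by (simp add: power_mono)
    qed
    have "full_norm f \<le> sqrt (full_norm (group_alg_star f * f))"
    proof (rule full_norm_le)
      fix p :: "('g \<Rightarrow>\<^sub>0 complex) \<Rightarrow> real" assume p: "cstar_seminorm p"
      then have "p (group_alg_star f * f) = (p f)\<^sup>2" by (simp add: cstar_seminorm_def)
      with up[OF p, of "group_alg_star f * f"]
      show "p f \<le> sqrt (full_norm (group_alg_star f * f))"
        by (simp add: real_le_rsqrt)
    qed
    then have "(full_norm f)\<^sup>2 \<le> (sqrt (full_norm (group_alg_star f * f)))\<^sup>2"
      by (intro power_mono full_norm_nonneg)
    then show "(full_norm f)\<^sup>2 \<le> full_norm (group_alg_star f * f)"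
      by (simp add: full_norm_nonneg)
  qed
  show ?thesis
    unfolding cstar_seminorm_def using full_norm_nonneg add mult sc sq by blast
qed

lemma full_norm_add: "full_norm (f + h) \<le> full_norm f + full_norm h"
  and full_norm_scale: "full_norm (Poly_Mapping.single 0 c * f) = cmod c * full_norm f"
  and full_norm_mult: "full_norm (f * h) \<le> full_norm f * full_norm h"
  and full_norm_star_mult: "full_norm (group_alg_star f * f) = (full_norm f)\<^sup>2"
  using cstar_seminorm_full_norm unfolding cstar_seminorm_def by blast+

lemma full_norm_zero [simp]: "full_norm 0 = 0"
  using full_norm_scale[of 0 0] by simp

lemma full_norm_minus [simp]: "full_norm (- f) = full_norm f"
  using full_norm_scale[of "-1" f] by (simp add: single_uminus)

lemma full_norm_minus_commute: "full_norm (f - h) = full_norm (h - f)"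
  using full_norm_minus[of "f - h"] by simp

lemma full_norm_triangle: "full_norm (f - k) \<le> full_norm (f - h) + full_norm (h - k)"
  using full_norm_add[of "f - h" "h - k"] by simp

lemma full_norm_diff_le: "\<bar>full_norm f - full_norm h\<bar> \<le> full_norm (f - h)"
  using full_norm_add[of "f - h" h] full_norm_add[of "h - f" f] full_norm_minus_commute[of f h] by simp

lemma full_norm_star [simp]: "full_norm (group_alg_star f) = full_norm f"
proof -
  have le: "full_norm h \<le> full_norm (group_alg_star h)" for h :: "'a \<Rightarrow>\<^sub>0 complex"
  proof (cases "full_norm h = 0")
    case False
    have "full_norm h * full_norm h \<le> full_norm (group_alg_star h) * full_norm h"
      using full_norm_mult[of "group_alg_star h" h] by (simp add: full_norm_star_mult power2_eq_square)
    with False full_norm_nonneg[of h] show ?thesis by simp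
  qed (simp add: full_norm_nonneg)
  show ?thesis using le[of f] le[of "group_alg_star f"] by simp
qed

lemma full_norm_one [simp]: "full_norm (1 :: 'g::group_add \<Rightarrow>\<^sub>0 complex) = 1"
proof -
  have "group_alg_lift (\<lambda>_::'g. 1::complex) 1 = 1"
    using group_alg_lift_single[of "\<lambda>_::'g. 1::complex" 0 1] by simp
  then have "1 \<le> full_norm (1 :: 'g \<Rightarrow>\<^sub>0 complex)"
    using cstar_seminorm_le_full_norm[OF
        cstar_seminorm_group_alg_lift[OF unitary_rep_trivial[where 'b = complex]], of "1 :: 'g \<Rightarrow>\<^sub>0 complex"] by simp
  moreover have "full_norm (1 :: 'g \<Rightarrow>\<^sub>0 complex) = full_norm (1 :: 'g \<Rightarrow>\<^sub>0 complex) * full_norm (1 :: 'g \<Rightarrow>\<^sub>0 complex)"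
    using full_norm_star_mult[of "1 :: 'g \<Rightarrow>\<^sub>0 complex"] by (simp add: power2_eq_square)
  ultimately show ?thesis by simp
qed


subsection \<open>Completion\<close>

text \<open>Cauchy sequences of the group algebra modulo null sequences; this also divides out the
  elements of full norm zero (of which there are in fact none).\<close>

definition full_Cauchy :: "(nat \<Rightarrow> ('g::group_add \<Rightarrow>\<^sub>0 complex)) \<Rightarrow> bool"
  where "full_Cauchy X \<longleftrightarrow> (\<forall>e>0. \<exists>M. \<forall>m\<ge>M. \<forall>n\<ge>M. full_norm (X m - X n) < e)"

definition full_rel :: "(nat \<Rightarrow> ('g::group_add \<Rightarrow>\<^sub>0 complex)) \<Rightarrow> (nat \<Rightarrow> ('g \<Rightarrow>\<^sub>0 complex)) \<Rightarrow> bool"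
  where "full_rel X Y \<longleftrightarrow>
    full_Cauchy X \<and> full_Cauchy Y \<and> (\<lambda>n. full_norm (X n - Y n)) \<longlonglongrightarrow> 0"

lemma full_Cauchy_const [simp]: "full_Cauchy (\<lambda>_. f)"
  by (simp add: full_Cauchy_def)

lemma full_rel_refl [simp]: "full_rel X X \<longleftrightarrow> full_Cauchy X"
  by (simp add: full_rel_def)

lemma tendsto_full_norm_le:
  assumes "f \<longlonglongrightarrow> 0" "\<And>n. full_norm (X n) \<le> f n"
  shows "(\<lambda>n. full_norm (X n)) \<longlonglongrightarrow> 0"
  by (rule tendsto_sandwich[OF _ _ tendsto_const assms(1)]) (simp_all add: full_norm_nonneg assms)

lemma full_rel_part_equivp:
  "part_equivp (full_rel :: (nat \<Rightarrow> 'g::group_add \<Rightarrow>\<^sub>0 complex) \<Rightarrow> _)"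
proof (rule part_equivpI)
  show "\<exists>X. (full_rel :: (nat \<Rightarrow> 'g \<Rightarrow>\<^sub>0 complex) \<Rightarrow> _) X X" by (auto intro: exI[of _ "\<lambda>_. 0"])
  show "symp (full_rel :: (nat \<Rightarrow> 'g \<Rightarrow>\<^sub>0 complex) \<Rightarrow> _)" by (rule sympI) (simp add: full_rel_def full_norm_minus_commute)
  show "transp (full_rel :: (nat \<Rightarrow> 'g \<Rightarrow>\<^sub>0 complex) \<Rightarrow> _)"
  proof (rule transpI)
    fix X Y Z :: "nat \<Rightarrow> 'g \<Rightarrow>\<^sub>0 complex"
    assume a: "full_rel X Y" "full_rel Y Z"
    then have "(\<lambda>n. full_norm (X n - Y n) + full_norm (Y n - Z n)) \<longlonglongrightarrow> 0 + 0"
      unfolding full_rel_def by (intro tendsto_add) auto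
    then have "(\<lambda>n. full_norm (X n - Z n)) \<longlonglongrightarrow> 0"
      by (intro tendsto_full_norm_le[of _ "\<lambda>n. X n - Z n"]) (auto intro: full_norm_triangle)
    with a show "full_rel X Z" by (simp add: full_rel_def)
  qed
qed

lemma full_CauchyD_norm:
  assumes "full_Cauchy X"
  shows "Cauchy (\<lambda>n. full_norm (X n))"
proof (rule CauchyI)
  fix e :: real assume "0 < e"
  then obtain M where "\<forall>m\<ge>M. \<forall>n\<ge>M. full_norm (X m - X n) < e"
    using assms unfolding full_Cauchy_def by blast
  then show "\<exists>M. \<forall>m\<ge>M. \<forall>n\<ge>M. norm (full_norm (X m) - full_norm (X n)) < e"
    using full_norm_diff_le by (metis order.strict_trans1 real_norm_def)
qed

lemma full_Cauchy_bounded: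
  assumes "full_Cauchy X"
  obtains B where "B > 0" "\<And>n. full_norm (X n) \<le> B"
proof -
  have "Bseq (\<lambda>n. full_norm (X n))"
    by (rule Cauchy_Bseq[OF full_CauchyD_norm[OF assms]])
  then obtain B where "B > 0" "\<And>n. norm (full_norm (X n)) \<le> B" by (auto elim: BseqE)
  then show ?thesis using that[of B] by (auto simp: full_norm_nonneg)
qed

lemma full_Cauchy_lipschitz:
  assumes "full_Cauchy X" "C \<ge> 0"
    "\<And>m n. full_norm (Y m - Y n) \<le> C * full_norm (X m - X n)"
  shows "full_Cauchy Y"
  unfolding full_Cauchy_def
proof (intro allI impI)
  fix e :: real assume e: "e > 0"
  then have "e / (C + 1) > 0" using assms(2) by simp
  then obtain M where M: "\<forall>m\<ge>M. \<forall>n\<ge>M. full_norm (X m - X n) < e / (C + 1)"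
    using assms(1) unfolding full_Cauchy_def by blast
  have "full_norm (Y m - Y n) < e" if "m \<ge> M" "n \<ge> M" for m n
  proof -
    have "full_norm (Y m - Y n) \<le> C * full_norm (X m - X n)" by (rule assms)
    also have "\<dots> \<le> (C + 1) * full_norm (X m - X n)"
      by (intro mult_right_mono) (auto simp: full_norm_nonneg)
    also have "\<dots> < (C + 1) * (e / (C + 1))"
      using M that assms(2) by (intro mult_strict_left_mono) auto
    finally show ?thesis using assms(2) by simp
  qed
  then show "\<exists>M. \<forall>m\<ge>M. \<forall>n\<ge>M. full_norm (Y m - Y n) < e" by blast
qed

lemma full_Cauchy_add [simp]:
  assumes "full_Cauchy X" "full_Cauchy Y"
  shows "full_Cauchy (\<lambda>n. X n + Y n)"
  unfolding full_Cauchy_def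
proof (intro allI impI)
  fix e :: real assume e: "e > 0"
  obtain M M' where "\<forall>m\<ge>M. \<forall>n\<ge>M. full_norm (X m - X n) < e/2"
    "\<forall>m\<ge>M'. \<forall>n\<ge>M'. full_norm (Y m - Y n) < e/2"
    using assms e unfolding full_Cauchy_def by (metis half_gt_zero)
  moreover have "full_norm (X m + Y m - (X n + Y n)) \<le> full_norm (X m - X n) + full_norm (Y m - Y n)" for m n
    using full_norm_add[of "X m - X n" "Y m - Y n"] by (simp add: algebra_simps)
  ultimately have "\<forall>m\<ge>max M M'. \<forall>n\<ge>max M M'. full_norm (X m + Y m - (X n + Y n)) < e"
    by (smt (verit, best) field_sum_of_halves max.bounded_iff)
  then show "\<exists>M. \<forall>m\<ge>M. \<forall>n\<ge>M. full_norm (X m + Y m - (X n + Y n)) < e" by blast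
qed

lemma full_Cauchy_scale [simp]:
  "full_Cauchy X \<Longrightarrow> full_Cauchy (\<lambda>n. Poly_Mapping.single 0 c * X n)"
  by (erule full_Cauchy_lipschitz[where C = "cmod c"])
    (auto simp: full_norm_scale simp flip: right_diff_distrib)

lemma full_Cauchy_minus [simp]: "full_Cauchy X \<Longrightarrow> full_Cauchy (\<lambda>n. - X n)"
  by (erule full_Cauchy_lipschitz[where C = 1]) (auto simp: full_norm_minus_commute)

lemma full_Cauchy_diff [simp]:
  assumes "full_Cauchy X" "full_Cauchy Y"
  shows "full_Cauchy (\<lambda>n. X n - Y n)"
  using full_Cauchy_add[OF assms(1) full_Cauchy_minus[OF assms(2)]] by simp

lemma full_Cauchy_star [simp]: "full_Cauchy X \<Longrightarrow> full_Cauchy (\<lambda>n. group_alg_star (X n))"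
  by (erule full_Cauchy_lipschitz[where C = 1]) (auto simp flip: group_alg_star_diff)

lemma full_norm_mult_diff:
  "full_norm (a * b - c * d) \<le> full_norm a * full_norm (b - d) + full_norm (a - c) * full_norm d"
proof -
  have "a * b - c * d = a * (b - d) + (a - c) * d" by (simp add: algebra_simps)
  then show ?thesis
    using full_norm_add[of "a * (b - d)" "(a - c) * d"] full_norm_mult[of a "b - d"]
      full_norm_mult[of "a - c" d] by simp
qed

lemma full_Cauchy_mult [simp]:
  assumes "full_Cauchy X" "full_Cauchy Y"
  shows "full_Cauchy (\<lambda>n. X n * Y n)"
  unfolding full_Cauchy_def
proof (intro allI impI)
  fix e :: real assume e: "e > 0"
  obtain B where B: "B > 0" "\<And>n. full_norm (X n) \<le> B" using full_Cauchy_bounded[OF assms(1)] by blast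
  obtain C where C: "C > 0" "\<And>n. full_norm (Y n) \<le> C" using full_Cauchy_bounded[OF assms(2)] by blast
  have "e / (2 * C) > 0" "e / (2 * B) > 0" using e B C by auto
  then obtain M M' where M: "\<forall>m\<ge>M. \<forall>n\<ge>M. full_norm (X m - X n) < e / (2 * C)"
    "\<forall>m\<ge>M'. \<forall>n\<ge>M'. full_norm (Y m - Y n) < e / (2 * B)"
    using assms unfolding full_Cauchy_def by meson
  have "full_norm (X m * Y m - X n * Y n) < e" if "m \<ge> max M M'" "n \<ge> max M M'" for m n
  proof -
    have "full_norm (X m * Y m - X n * Y n)
        \<le> full_norm (X m) * full_norm (Y m - Y n) + full_norm (X m - X n) * full_norm (Y n)"
      by (rule full_norm_mult_diff)
    also have "\<dots> \<le> B * full_norm (Y m - Y n) + full_norm (X m - X n) * C"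
      by (intro add_mono mult_mono) (auto simp: B C full_norm_nonneg less_imp_le)
    also have "\<dots> < B * (e / (2 * B)) + e / (2 * C) * C"
    proof (rule add_strict_mono)
      show "B * full_norm (Y m - Y n) < B * (e / (2 * B))"
        using M(2) that B(1) by (intro mult_strict_left_mono) auto
      show "full_norm (X m - X n) * C < e / (2 * C) * C"
        using M(1) that C(1) by (intro mult_strict_right_mono) auto
    qed
    also have "\<dots> = e" using B C by (simp add: field_simps)
    finally show ?thesis .
  qed
  then show "\<exists>M. \<forall>m\<ge>M. \<forall>n\<ge>M. full_norm (X m * Y m - X n * Y n) < e" by blast
qed

quotient_type (overloaded) 'g group_cstar = "nat \<Rightarrow> ('g::group_add \<Rightarrow>\<^sub>0 complex)" / partial: full_rel
  by (rule full_rel_part_equivp)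

lemma group_cstar_eq_iff:
  "full_Cauchy X \<Longrightarrow> full_Cauchy Y \<Longrightarrow>
    abs_group_cstar X = abs_group_cstar Y \<longleftrightarrow> (\<lambda>n. full_norm (X n - Y n)) \<longlonglongrightarrow> 0"
  using Quotient3_rel[OF Quotient3_group_cstar, of X Y] by (auto simp: full_rel_def)

lemma group_cstar_exhaust:
  obtains X where "full_Cauchy X" "a = abs_group_cstar X"
  using Quotient3_abs_rep[OF Quotient3_group_cstar, of a] Quotient3_rep_reflp[OF Quotient3_group_cstar, of a]
  by (metis full_rel_refl)

instantiation group_cstar :: (group_add) "{real_normed_algebra_1, scaleC, star}"
begin

lift_definition zero_group_cstar :: "'a group_cstar" is "\<lambda>_. 0" by simp

lift_definition one_group_cstar :: "'a group_cstar" is "\<lambda>_. 1" by simp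

lift_definition plus_group_cstar :: "'a group_cstar \<Rightarrow> 'a group_cstar \<Rightarrow> 'a group_cstar"
  is "\<lambda>X Y n. X n + Y n"
proof -
  fix X X' Y Y' :: "nat \<Rightarrow> 'a \<Rightarrow>\<^sub>0 complex"
  assume a: "full_rel X X'" "full_rel Y Y'"
  then have "(\<lambda>n. full_norm (X n - X' n) + full_norm (Y n - Y' n)) \<longlonglongrightarrow> 0 + 0"
    unfolding full_rel_def by (intro tendsto_add) auto
  moreover have "full_norm (X n + Y n - (X' n + Y' n)) \<le> full_norm (X n - X' n) + full_norm (Y n - Y' n)" for n
    using full_norm_add[of "X n - X' n" "Y n - Y' n"] by (simp add: algebra_simps)
  ultimately have "(\<lambda>n. full_norm (X n + Y n - (X' n + Y' n))) \<longlonglongrightarrow> 0"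
    by (intro tendsto_full_norm_le[of _ "\<lambda>n. X n + Y n - (X' n + Y' n)"]) auto
  with a show "full_rel (\<lambda>n. X n + Y n) (\<lambda>n. X' n + Y' n)" by (simp add: full_rel_def)
qed

lift_definition uminus_group_cstar :: "'a group_cstar \<Rightarrow> 'a group_cstar" is "\<lambda>X n. - X n"
  by (auto simp: full_rel_def full_norm_minus_commute)

definition minus_group_cstar :: "'a group_cstar \<Rightarrow> 'a group_cstar \<Rightarrow> 'a group_cstar"
  where "minus_group_cstar a b = a + - b"

lift_definition times_group_cstar :: "'a group_cstar \<Rightarrow> 'a group_cstar \<Rightarrow> 'a group_cstar"
  is "\<lambda>X Y n. X n * Y n"
proof -
  fix X X' Y Y' :: "nat \<Rightarrow> 'a \<Rightarrow>\<^sub>0 complex"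
  assume a: "full_rel X X'" "full_rel Y Y'"
  then have c: "full_Cauchy X" "full_Cauchy Y'" by (simp_all add: full_rel_def)
  obtain B where B: "B > 0" "\<And>n. full_norm (X n) \<le> B" using full_Cauchy_bounded[OF c(1)] by blast
  obtain C where C: "C > 0" "\<And>n. full_norm (Y' n) \<le> C" using full_Cauchy_bounded[OF c(2)] by blast
  have "(\<lambda>n. B * full_norm (Y n - Y' n) + full_norm (X n - X' n) * C) \<longlonglongrightarrow> B * 0 + 0 * C"
    using a unfolding full_rel_def by (intro tendsto_intros) auto
  moreover have "full_norm (X n * Y n - X' n * Y' n) \<le> B * full_norm (Y n - Y' n) + full_norm (X n - X' n) * C" for n
    by (rule order_trans[OF full_norm_mult_diff])
      (intro add_mono mult_mono; auto simp: B C full_norm_nonneg less_imp_le)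
  ultimately have "(\<lambda>n. full_norm (X n * Y n - X' n * Y' n)) \<longlonglongrightarrow> 0"
    by (intro tendsto_full_norm_le[of _ "\<lambda>n. X n * Y n - X' n * Y' n"]) auto
  with a show "full_rel (\<lambda>n. X n * Y n) (\<lambda>n. X' n * Y' n)" by (simp add: full_rel_def)
qed

lift_definition scaleC_group_cstar :: "complex \<Rightarrow> 'a group_cstar \<Rightarrow> 'a group_cstar"
  is "\<lambda>c X n. Poly_Mapping.single 0 c * X n"
  by (auto simp: full_rel_def full_norm_scale tendsto_mult_right_zero simp flip: right_diff_distrib)

definition scaleR_group_cstar :: "real \<Rightarrow> 'a group_cstar \<Rightarrow> 'a group_cstar"
  where "scaleR_group_cstar r a = complex_of_real r *\<^sub>C a"

lift_definition star_group_cstar :: "'a group_cstar \<Rightarrow> 'a group_cstar"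
  is "\<lambda>X n. group_alg_star (X n)"
  by (auto simp: full_rel_def simp flip: group_alg_star_diff)

lift_definition norm_group_cstar :: "'a group_cstar \<Rightarrow> real"
  is "\<lambda>X. lim (\<lambda>n. full_norm (X n))"
proof -
  fix X Y :: "nat \<Rightarrow> 'a \<Rightarrow>\<^sub>0 complex"
  assume a: "full_rel X Y"
  then obtain l where l: "(\<lambda>n. full_norm (X n)) \<longlonglongrightarrow> l"
    using full_CauchyD_norm[of X] Cauchy_convergent_iff convergent_def
    unfolding full_rel_def by blast
  have "(\<lambda>n. full_norm (X n) - full_norm (Y n)) \<longlonglongrightarrow> 0"
    by (rule Lim_null_comparison[where g = "\<lambda>n. full_norm (X n - Y n)"])
      (use a in \<open>auto simp: full_rel_def full_norm_diff_le intro!: always_eventually\<close>)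
  from tendsto_diff[OF l this] have "(\<lambda>n. full_norm (Y n)) \<longlonglongrightarrow> l" by simp
  with l show "lim (\<lambda>n. full_norm (X n)) = lim (\<lambda>n. full_norm (Y n))"
    by (simp add: limI)
qed

definition dist_group_cstar :: "'a group_cstar \<Rightarrow> 'a group_cstar \<Rightarrow> real"
  where "dist_group_cstar a b = norm (a - b)"

definition sgn_group_cstar :: "'a group_cstar \<Rightarrow> 'a group_cstar"
  where "sgn_group_cstar a = inverse (norm a) *\<^sub>R a"

definition uniformity_group_cstar :: "('a group_cstar \<times> 'a group_cstar) filter"
  where "uniformity_group_cstar = (INF e\<in>{0<..}. principal {(a, b). dist a b < e})"

definition open_group_cstar :: "'a group_cstar set \<Rightarrow> bool"
  where "open_group_cstar S = (\<forall>a\<in>S. \<forall>\<^sub>F (a', b) in uniformity. a' = a \<longrightarrow> b \<in> S)"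

lemma minus_group_cstar_abs:
  "full_Cauchy X \<Longrightarrow> full_Cauchy Y \<Longrightarrow>
    abs_group_cstar X - abs_group_cstar Y = abs_group_cstar (\<lambda>n. X n - Y n)"
  by (simp add: minus_group_cstar_def plus_group_cstar.abs_eq uminus_group_cstar.abs_eq)

lemmas group_cstar_abs_eqs =
  zero_group_cstar.abs_eq one_group_cstar.abs_eq plus_group_cstar.abs_eq uminus_group_cstar.abs_eq
  times_group_cstar.abs_eq scaleC_group_cstar.abs_eq star_group_cstar.abs_eq minus_group_cstar_abs

lemma norm_group_cstar_tendsto:
  assumes "full_Cauchy X"
  shows "(\<lambda>n. full_norm (X n)) \<longlonglongrightarrow> norm (abs_group_cstar X)"
proof -
  have "convergent (\<lambda>n. full_norm (X n))"
    using full_CauchyD_norm[OF assms] by (simp add: Cauchy_convergent_iff)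
  then show ?thesis using assms by (simp add: norm_group_cstar.abs_eq convergent_LIMSEQ_iff)
qed

lemma norm_group_cstar_const [simp]: "norm (abs_group_cstar (\<lambda>_. f)) = full_norm f"
  by (rule LIMSEQ_unique[OF norm_group_cstar_tendsto tendsto_const]) simp

lemma norm_group_cstar_zero_iff: "norm (a :: 'a group_cstar) = 0 \<longleftrightarrow> a = 0"
proof (cases a rule: group_cstar_exhaust)
  case (1 X)
  have "a = 0 \<longleftrightarrow> (\<lambda>n. full_norm (X n)) \<longlonglongrightarrow> 0"
    using group_cstar_eq_iff[of X "\<lambda>_. 0"] 1 by (simp add: zero_group_cstar.abs_eq)
  then show ?thesis
    using norm_group_cstar_tendsto[OF 1(1)] 1(2) LIMSEQ_unique by auto
qed

lemma norm_group_cstar_triangle: "norm (a + b) \<le> norm a + norm (b :: 'a group_cstar)"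
proof (cases a rule: group_cstar_exhaust)
  case X: (1 X)
  show ?thesis
  proof (cases b rule: group_cstar_exhaust)
    case Y: (1 Y)
    have "(\<lambda>n. full_norm (X n + Y n)) \<longlonglongrightarrow> norm (a + b)"
      using norm_group_cstar_tendsto[of "\<lambda>n. X n + Y n"] X Y by (simp add: plus_group_cstar.abs_eq)
    moreover have "(\<lambda>n. full_norm (X n) + full_norm (Y n)) \<longlonglongrightarrow> norm a + norm b"
      unfolding X(2) Y(2) by (intro tendsto_add norm_group_cstar_tendsto X Y)
    ultimately show ?thesis by (rule LIMSEQ_le) (auto intro: full_norm_add)
  qed
qed

lemma norm_group_cstar_mult: "norm (a * b) \<le> norm a * norm (b :: 'a group_cstar)"
proof (cases a rule: group_cstar_exhaust)
  case X: (1 X)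
  show ?thesis
  proof (cases b rule: group_cstar_exhaust)
    case Y: (1 Y)
    have "(\<lambda>n. full_norm (X n * Y n)) \<longlonglongrightarrow> norm (a * b)"
      using norm_group_cstar_tendsto[of "\<lambda>n. X n * Y n"] X Y by (simp add: times_group_cstar.abs_eq)
    moreover have "(\<lambda>n. full_norm (X n) * full_norm (Y n)) \<longlonglongrightarrow> norm a * norm b"
      unfolding X(2) Y(2) by (intro tendsto_mult norm_group_cstar_tendsto X Y)
    ultimately show ?thesis by (rule LIMSEQ_le) (auto intro: full_norm_mult)
  qed
qed

lemma norm_group_cstar_scaleC: "norm (c *\<^sub>C a) = cmod c * norm (a :: 'a group_cstar)"
proof (cases a rule: group_cstar_exhaust)
  case (1 X)
  have "(\<lambda>n. full_norm (Poly_Mapping.single 0 c * X n)) \<longlonglongrightarrow> norm (c *\<^sub>C a)"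
    using norm_group_cstar_tendsto[of "\<lambda>n. Poly_Mapping.single 0 c * X n"] 1
    by (simp add: scaleC_group_cstar.abs_eq)
  moreover have "(\<lambda>n. cmod c * full_norm (X n)) \<longlonglongrightarrow> cmod c * norm a"
    unfolding 1(2) by (intro tendsto_mult tendsto_const norm_group_cstar_tendsto 1)
  ultimately show ?thesis by (simp add: full_norm_scale LIMSEQ_unique)
qed

lemma norm_group_cstar_star: "norm (star a * a) = (norm (a :: 'a group_cstar))\<^sup>2"
proof (cases a rule: group_cstar_exhaust)
  case (1 X)
  have "(\<lambda>n. full_norm (group_alg_star (X n) * X n)) \<longlonglongrightarrow> norm (star a * a)"
    using norm_group_cstar_tendsto[of "\<lambda>n. group_alg_star (X n) * X n"] 1
    by (simp add: times_group_cstar.abs_eq star_group_cstar.abs_eq)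
  moreover have "(\<lambda>n. (full_norm (X n))\<^sup>2) \<longlonglongrightarrow> (norm a)\<^sup>2"
    unfolding 1(2) by (intro tendsto_power norm_group_cstar_tendsto 1)
  ultimately show ?thesis by (simp add: full_norm_star_mult LIMSEQ_unique)
qed

lemma scaleC_group_cstar_eqs:
  fixes a b :: "'a group_cstar"
  shows "z *\<^sub>C (a + b) = z *\<^sub>C a + z *\<^sub>C b" "(z + w) *\<^sub>C a = z *\<^sub>C a + w *\<^sub>C a"
    "z *\<^sub>C w *\<^sub>C a = (z * w) *\<^sub>C a"
    "(z *\<^sub>C a) * b = z *\<^sub>C (a * b)" "a * (z *\<^sub>C b) = z *\<^sub>C (a * b)"
proof -
  obtain X Y where ab: "full_Cauchy X" "a = abs_group_cstar X" "full_Cauchy Y" "b = abs_group_cstar Y"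
    by (metis group_cstar_exhaust)
  have "f * (Poly_Mapping.single 0 z * h) = Poly_Mapping.single 0 z * (f * h)" for f h :: "'a \<Rightarrow>\<^sub>0 complex"
    by (metis mult.assoc single_zero_commute)
  then show "a * (z *\<^sub>C b) = z *\<^sub>C (a * b)" using ab by (simp add: group_cstar_abs_eqs)
  show "z *\<^sub>C w *\<^sub>C a = (z * w) *\<^sub>C a"
    using ab by (simp add: group_cstar_abs_eqs mult_single flip: mult.assoc)
  show "z *\<^sub>C (a + b) = z *\<^sub>C a + z *\<^sub>C b" "(z + w) *\<^sub>C a = z *\<^sub>C a + w *\<^sub>C a"
    "(z *\<^sub>C a) * b = z *\<^sub>C (a * b)"
    using ab by (simp_all add: group_cstar_abs_eqs single_add distrib_left distrib_right mult.assoc)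
qed

instance
proof
  fix a b c :: "'a group_cstar" and r s :: real
  obtain X Y Z where abc: "full_Cauchy X" "a = abs_group_cstar X"
    "full_Cauchy Y" "b = abs_group_cstar Y" "full_Cauchy Z" "c = abs_group_cstar Z"
    by (metis group_cstar_exhaust)
  show "a + b + c = a + (b + c)" "a + b = b + a" "0 + a = a" "- a + a = 0"
    "a * b * c = a * (b * c)" "(a + b) * c = a * c + b * c" "a * (b + c) = a * b + a * c"
    "1 * a = a" "a * 1 = a"
    using abc by (simp_all add: group_cstar_abs_eqs algebra_simps)
  show "a - b = a + - b" by (rule minus_group_cstar_def)
  show n1: "norm (1::'a group_cstar) = 1" by (simp add: one_group_cstar.abs_eq)
  show "(0::'a group_cstar) \<noteq> 1" using n1 norm_group_cstar_zero_iff[of 1] by auto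
  show "r *\<^sub>R (a + b) = r *\<^sub>R a + r *\<^sub>R b" "(r + s) *\<^sub>R a = r *\<^sub>R a + s *\<^sub>R a"
    "r *\<^sub>R s *\<^sub>R a = (r * s) *\<^sub>R a" "r *\<^sub>R a * b = r *\<^sub>R (a * b)" "a * r *\<^sub>R b = r *\<^sub>R (a * b)"
    by (simp_all add: scaleR_group_cstar_def scaleC_group_cstar_eqs)
  show "1 *\<^sub>R a = a"
    using abc by (simp add: scaleR_group_cstar_def group_cstar_abs_eqs)
  show "norm (r *\<^sub>R a) = \<bar>r\<bar> * norm a" by (simp add: scaleR_group_cstar_def norm_group_cstar_scaleC)
  show "dist a b = norm (a - b)" by (rule dist_group_cstar_def)
  show "sgn a = inverse (norm a) *\<^sub>R a" by (rule sgn_group_cstar_def)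
  show "uniformity = (INF e\<in>{0<..}. principal {(a, b :: 'a group_cstar). dist a b < e})"
    by (rule uniformity_group_cstar_def)
  show "open S = (\<forall>a\<in>S. \<forall>\<^sub>F (a', b) in uniformity. a' = a \<longrightarrow> b \<in> S)" for S :: "'a group_cstar set"
    by (rule open_group_cstar_def)
  show "norm a = 0 \<longleftrightarrow> a = 0" by (rule norm_group_cstar_zero_iff)
  show "norm (a + b) \<le> norm a + norm b" by (rule norm_group_cstar_triangle)
  show "norm (a * b) \<le> norm a * norm b" by (rule norm_group_cstar_mult)
qed

end

lemma tendsto_abs_group_cstar:
  assumes "full_Cauchy X"
  shows "(\<lambda>n. abs_group_cstar (\<lambda>_. X n)) \<longlonglongrightarrow> abs_group_cstar X"
proof (rule LIMSEQ_I)
  fix e :: real assume e: "e > 0"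
  then obtain M where M: "\<forall>m\<ge>M. \<forall>n\<ge>M. full_norm (X m - X n) < e/2"
    using assms unfolding full_Cauchy_def by (meson half_gt_zero)
  have "norm (abs_group_cstar (\<lambda>_. X m) - abs_group_cstar X) < e" if "m \<ge> M" for m
  proof -
    have "(\<lambda>n. full_norm (X m - X n)) \<longlonglongrightarrow> norm (abs_group_cstar (\<lambda>_. X m) - abs_group_cstar X)"
      using norm_group_cstar_tendsto[of "\<lambda>n. X m - X n"] assms by (simp add: minus_group_cstar_abs)
    then have "norm (abs_group_cstar (\<lambda>_. X m) - abs_group_cstar X) \<le> e/2"
      by (rule LIMSEQ_le_const2) (use M that in \<open>auto intro: less_imp_le\<close>)
    with e show ?thesis by simp
  qed
  then show "\<exists>M. \<forall>m\<ge>M. norm (abs_group_cstar (\<lambda>_. X m) - abs_group_cstar X) < e" by blast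
qed

lemma group_cstar_approx:
  fixes a :: "'g::group_add group_cstar"
  assumes "e > 0"
  obtains f where "norm (a - abs_group_cstar (\<lambda>_. f)) < e"
proof -
  obtain X where "full_Cauchy X" "a = abs_group_cstar X" by (rule group_cstar_exhaust)
  then have "(\<lambda>n. abs_group_cstar (\<lambda>_. X n)) \<longlonglongrightarrow> a" by (simp add: tendsto_abs_group_cstar)
  from LIMSEQ_D[OF this assms] obtain n where "norm (abs_group_cstar (\<lambda>_. X n) - a) < e" by blast
  then show ?thesis using that[of "X n"] by (simp add: norm_minus_commute)
qed

instance group_cstar :: (group_add) complete_space
proof
  fix F :: "nat \<Rightarrow> 'a group_cstar"
  assume F: "Cauchy F"
  have "\<exists>f. norm (F n - abs_group_cstar (\<lambda>_. f)) < 1 / real (Suc n)" for n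
    by (rule group_cstar_approx[of "1 / real (Suc n)" "F n"]) auto
  then obtain X where X: "\<And>n. norm (F n - abs_group_cstar (\<lambda>_. X n)) < 1 / real (Suc n)" by metis
  let ?G = "\<lambda>n. abs_group_cstar (\<lambda>_. X n)"
  have FG: "(\<lambda>n. F n - ?G n) \<longlonglongrightarrow> 0"
    by (rule Lim_null_comparison[OF _ LIMSEQ_inverse_real_of_nat])
      (use X in \<open>auto intro!: always_eventually less_imp_le simp: inverse_eq_divide\<close>)
  have "Cauchy ?G"
  proof (rule CauchyI)
    fix e :: real assume e: "e > 0"
    obtain M1 where M1: "\<forall>m\<ge>M1. \<forall>n\<ge>M1. norm (F m - F n) < e/3"
      using F e unfolding Cauchy_iff by (meson divide_pos_pos zero_less_numeral)
    obtain M2 where M2: "\<forall>n\<ge>M2. norm (F n - ?G n) < e/3"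
      using LIMSEQ_D[OF FG, of "e/3"] e by auto
    have "norm (?G m - ?G n) < e" if mn: "m \<ge> max M1 M2" "n \<ge> max M1 M2" for m n
    proof -
      have eq: "?G m - ?G n = (F m - F n) - (F m - ?G m) + (F n - ?G n)" by simp
      have "norm (?G m - ?G n) \<le> norm ((F m - F n) - (F m - ?G m)) + norm (F n - ?G n)"
        unfolding eq by (rule norm_triangle_ineq)
      also have "\<dots> \<le> norm (F m - F n) + norm (F m - ?G m) + norm (F n - ?G n)"
        by (intro add_right_mono norm_triangle_ineq4)
      also have "\<dots> < e/3 + e/3 + e/3"
        using M1 M2 mn by (intro add_strict_mono) auto
      finally show ?thesis by simp
    qed
    then show "\<exists>M. \<forall>m\<ge>M. \<forall>n\<ge>M. norm (?G m - ?G n) < e" by blast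
  qed
  then have "full_Cauchy X"
    unfolding Cauchy_iff full_Cauchy_def by (simp add: minus_group_cstar_abs)
  then have "?G \<longlonglongrightarrow> abs_group_cstar X" by (rule tendsto_abs_group_cstar)
  from tendsto_add[OF FG this] show "convergent F" by (auto simp: convergent_def)
qed

instance group_cstar :: (group_add) cstar_algebra
proof
  fix a b :: "'a group_cstar" and r :: real and z w :: complex
  obtain X Y where ab: "full_Cauchy X" "a = abs_group_cstar X" "full_Cauchy Y" "b = abs_group_cstar Y"
    by (metis group_cstar_exhaust)
  show "z *\<^sub>C (a + b) = z *\<^sub>C a + z *\<^sub>C b" "(z + w) *\<^sub>C a = z *\<^sub>C a + w *\<^sub>C a"
    "z *\<^sub>C w *\<^sub>C a = (z * w) *\<^sub>C a"
    "(z *\<^sub>C a) * b = z *\<^sub>C (a * b)" "a * (z *\<^sub>C b) = z *\<^sub>C (a * b)"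
    by (rule scaleC_group_cstar_eqs)+
  show "r *\<^sub>R a = complex_of_real r *\<^sub>C a" by (rule scaleR_group_cstar_def)
  show "norm (z *\<^sub>C a) = cmod z * norm a" by (rule norm_group_cstar_scaleC)
  show "star (a + b) = star a + star b" "star (a * b) = star b * star a"
    "star (z *\<^sub>C a) = cnj z *\<^sub>C star a" "star (star a) = a"
    using ab
    by (simp_all add: group_cstar_abs_eqs group_alg_star_add group_alg_star_mult single_zero_commute)
  show "norm (star a * a) = (norm a)\<^sup>2" by (rule norm_group_cstar_star)
qed


subsection \<open>Universal property\<close>

definition group_unitary :: "'g::group_add \<Rightarrow> 'g group_cstar"
  where "group_unitary g = abs_group_cstar (\<lambda>_. Poly_Mapping.single g 1)"

lemma unitary_rep_group_unitary: "unitary_rep group_unitary"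
  by (simp add: unitary_rep_def unitary_def group_unitary_def group_cstar_abs_eqs mult_single)

lemma group_alg_lift_group_unitary: "group_alg_lift group_unitary f = abs_group_cstar (\<lambda>_. f)"
  by (induction f rule: group_alg_induct)
    (simp_all add: group_alg_lift_single group_alg_lift_add group_unitary_def group_cstar_abs_eqs mult_single)

lemma group_alg_lift_diff: "group_alg_lift U (f - h) = group_alg_lift U f - group_alg_lift U h"
  using group_alg_lift_add[of U "f - h" h] by (simp add: algebra_simps)

lemma star_hom_group_alg_lift:
  assumes "star_hom h"
  shows "h (group_alg_lift U f) = group_alg_lift (\<lambda>g. h (U g)) f"
  using assms by (induction f rule: group_alg_induct)
    (simp_all add: star_hom_def group_alg_lift_single group_alg_lift_add)

lemma star_hom_diff: "star_hom h \<Longrightarrow> h (x - y) = h x - h y"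
  using diff_add_cancel[of x y] unfolding star_hom_def by (metis add_diff_cancel_right')

lemma star_hom_group_cstar_eqI:
  fixes h k :: "'g::group_add group_cstar \<Rightarrow> 'b::cstar_algebra"
  assumes "star_hom h" "star_hom k" "\<And>g. h (group_unitary g) = k (group_unitary g)"
  shows "h = k"
proof
  fix a
  have "norm (h a - k a) \<le> 0"
  proof (rule field_le_epsilon)
    fix e :: real assume "e > 0"
    then have "e/2 > 0" by simp
    then obtain f where f: "norm (a - abs_group_cstar (\<lambda>_. f)) < e/2" by (rule group_cstar_approx)
    let ?f = "abs_group_cstar (\<lambda>_. f)"
    have "h ?f = k ?f"
      using assms by (simp flip: group_alg_lift_group_unitary add: star_hom_group_alg_lift)
    then have "h a - k a = h (a - ?f) - k (a - ?f)"
      using assms by (simp add: star_hom_diff)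
    then have "norm (h a - k a) \<le> norm (h (a - ?f)) + norm (k (a - ?f))"
      by (simp add: norm_triangle_ineq4)
    also have "\<dots> \<le> norm (a - ?f) + norm (a - ?f)"
      by (intro add_mono star_hom_contractive assms)
    finally show "norm (h a - k a) \<le> 0 + e" using f by simp
  qed
  then show "h a = k a" by simp
qed

lemma group_cstar_extension_exists:
  fixes U :: "'g::group_add \<Rightarrow> 'b::cstar_algebra"
  assumes U: "unitary_rep U"
  shows "\<exists>h. star_hom h \<and> (\<forall>g. h (group_unitary g) = U g)"
proof -
  let ?L = "group_alg_lift U"
  have le: "norm (?L f) \<le> full_norm f" for f
    using cstar_seminorm_le_full_norm[OF cstar_seminorm_group_alg_lift[OF U]] .
  define h where "h a = lim (\<lambda>n. ?L (rep_group_cstar a n))" for a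
  have lim: "(\<lambda>n. ?L (X n)) \<longlonglongrightarrow> h (abs_group_cstar X)" if X: "full_Cauchy X" for X
  proof -
    let ?Y = "rep_group_cstar (abs_group_cstar X)"
    have Y: "full_Cauchy ?Y" "abs_group_cstar ?Y = abs_group_cstar X"
      using Quotient3_rep_reflp[OF Quotient3_group_cstar] Quotient3_abs_rep[OF Quotient3_group_cstar]
      by (metis full_rel_refl)+
    have "Cauchy (\<lambda>n. ?L (?Y n))"
    proof (rule CauchyI)
      fix e :: real assume "e > 0"
      then obtain M where "\<forall>m\<ge>M. \<forall>n\<ge>M. full_norm (?Y m - ?Y n) < e"
        using Y unfolding full_Cauchy_def by blast
      then show "\<exists>M. \<forall>m\<ge>M. \<forall>n\<ge>M. norm (?L (?Y m) - ?L (?Y n)) < e"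
        using le by (metis group_alg_lift_diff order.strict_trans1)
    qed
    then have l: "(\<lambda>n. ?L (?Y n)) \<longlonglongrightarrow> h (abs_group_cstar X)"
      by (simp add: h_def Cauchy_convergent_iff convergent_LIMSEQ_iff)
    have "(\<lambda>n. full_norm (X n - ?Y n)) \<longlonglongrightarrow> 0"
      using group_cstar_eq_iff[OF X Y(1)] Y(2) by simp
    then have "(\<lambda>n. ?L (X n) - ?L (?Y n)) \<longlonglongrightarrow> 0"
      by (rule Lim_null_comparison[rotated])
        (simp add: le flip: group_alg_lift_diff)
    from tendsto_add[OF this l] show ?thesis by simp
  qed
  have "star_hom h"
    unfolding star_hom_def
  proof (intro conjI allI)
    fix x y :: "'g group_cstar" and c :: complex
    obtain X Y where xy: "full_Cauchy X" "x = abs_group_cstar X" "full_Cauchy Y" "y = abs_group_cstar Y"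
      by (metis group_cstar_exhaust)
    have X: "(\<lambda>n. ?L (X n)) \<longlonglongrightarrow> h x" and Y: "(\<lambda>n. ?L (Y n)) \<longlonglongrightarrow> h y"
      using lim xy by auto
    have "(\<lambda>n. ?L (X n + Y n)) \<longlonglongrightarrow> h (x + y)"
      using lim[of "\<lambda>n. X n + Y n"] xy by (simp add: group_cstar_abs_eqs)
    moreover have "(\<lambda>n. ?L (X n + Y n)) \<longlonglongrightarrow> h x + h y"
      using tendsto_add[OF X Y] by (simp add: group_alg_lift_add)
    ultimately show "h (x + y) = h x + h y" by (rule LIMSEQ_unique)
    have "(\<lambda>n. ?L (X n * Y n)) \<longlonglongrightarrow> h (x * y)"
      using lim[of "\<lambda>n. X n * Y n"] xy by (simp add: group_cstar_abs_eqs)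
    moreover have "(\<lambda>n. ?L (X n * Y n)) \<longlonglongrightarrow> h x * h y"
      using tendsto_mult[OF X Y] by (simp add: group_alg_lift_mult[OF U])
    ultimately show "h (x * y) = h x * h y" by (rule LIMSEQ_unique)
    have "(\<lambda>n. ?L (Poly_Mapping.single 0 c * X n)) \<longlonglongrightarrow> h (c *\<^sub>C x)"
      using lim[of "\<lambda>n. Poly_Mapping.single 0 c * X n"] xy by (simp add: group_cstar_abs_eqs)
    moreover have "?L (Poly_Mapping.single 0 c * f) = (c *\<^sub>C 1) * ?L f" for f
      by (simp add: group_alg_lift_mult[OF U] group_alg_lift_single unitary_rep_zero[OF U])
    moreover have "(\<lambda>n. (c *\<^sub>C 1) * ?L (X n)) \<longlonglongrightarrow> (c *\<^sub>C 1) * h x"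
      by (intro tendsto_mult tendsto_const X)
    ultimately have "h (c *\<^sub>C x) = (c *\<^sub>C 1) * h x" using LIMSEQ_unique by simp
    then show "h (c *\<^sub>C x) = c *\<^sub>C h x" by (simp add: mult_scaleC_left)
    have "(\<lambda>n. ?L (group_alg_star (X n))) \<longlonglongrightarrow> h (star x)"
      using lim[of "\<lambda>n. group_alg_star (X n)"] xy by (simp add: group_cstar_abs_eqs)
    moreover have "(\<lambda>n. ?L (group_alg_star (X n))) \<longlonglongrightarrow> star (h x)"
      using bounded_linear.tendsto[OF bounded_linear_star X] by (simp add: group_alg_lift_star[OF U])
    ultimately show "h (star x) = star (h x)" by (rule LIMSEQ_unique)
    have "(\<lambda>n::nat. ?L 1) \<longlonglongrightarrow> h 1"
      using lim[of "\<lambda>_. 1"] by (simp add: group_cstar_abs_eqs)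
    moreover have "?L 1 = 1"
      using group_alg_lift_single[of U 0 1] by (simp add: unitary_rep_zero[OF U])
    ultimately show "h 1 = 1" by (simp add: LIMSEQ_const_iff)
  qed
  moreover have "h (group_unitary g) = U g" for g
    using lim[of "\<lambda>_. Poly_Mapping.single g 1"]
    by (simp add: group_unitary_def group_alg_lift_single LIMSEQ_const_iff)
  ultimately show ?thesis by blast
qed

theorem group_cstar_universal:
  fixes U :: "'g::group_add \<Rightarrow> 'b::cstar_algebra"
  assumes "unitary_rep U"
  shows "\<exists>!h. star_hom h \<and> (\<forall>g. h (group_unitary g) = U g)"
proof (rule ex_ex1I)
  show "h = k" if "star_hom h \<and> (\<forall>g. h (group_unitary g) = U g)"
    "star_hom k \<and> (\<forall>g. k (group_unitary g) = U g)" for h k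
    using that by (intro star_hom_group_cstar_eqI) simp_all
qed (rule group_cstar_extension_exists[OF assms])


section \<open>Free groups\<close>

text \<open>The letters \<open>(a, True)\<close> and \<open>(a, False)\<close> stand for the generator \<open>a\<close> and its inverse.\<close>

inductive free_eq :: "('a \<times> bool) list \<Rightarrow> ('a \<times> bool) list \<Rightarrow> bool"
  where
    free_eq_refl: "free_eq xs xs"
  | free_eq_sym: "free_eq xs ys \<Longrightarrow> free_eq ys xs"
  | free_eq_trans: "free_eq xs ys \<Longrightarrow> free_eq ys zs \<Longrightarrow> free_eq xs zs"
  | free_eq_cancel: "free_eq (xs @ (a, b) # (a, \<not> b) # ys) (xs @ ys)"

lemma free_eq_append_left: "free_eq xs ys \<Longrightarrow> free_eq (zs @ xs) (zs @ ys)"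
proof (induction rule: free_eq.induct)
  case (free_eq_cancel xs a b ys)
  show ?case using free_eq.free_eq_cancel[of "zs @ xs" a b ys] by simp
qed (blast intro: free_eq.intros)+

lemma free_eq_append_right: "free_eq xs ys \<Longrightarrow> free_eq (xs @ zs) (ys @ zs)"
proof (induction rule: free_eq.induct)
  case (free_eq_cancel xs a b ys)
  show ?case using free_eq.free_eq_cancel[of xs a b "ys @ zs"] by simp
qed (blast intro: free_eq.intros)+

definition word_inverse :: "('a \<times> bool) list \<Rightarrow> ('a \<times> bool) list"
  where "word_inverse xs = rev (map (\<lambda>(a, b). (a, \<not> b)) xs)"

lemma free_eq_word_inverse: "free_eq xs ys \<Longrightarrow> free_eq (word_inverse xs) (word_inverse ys)"
proof (induction rule: free_eq.induct)
  case (free_eq_cancel xs a b ys)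
  show ?case
    using free_eq.free_eq_cancel[of "word_inverse ys" a b "word_inverse xs"]
    by (simp add: word_inverse_def)
qed (blast intro: free_eq.intros)+

lemma free_eq_word_inverse_left: "free_eq (word_inverse xs @ xs) []"
proof (induction xs)
  case (Cons x xs)
  have "free_eq (word_inverse xs @ (fst x, \<not> snd x) # (fst x, \<not> \<not> snd x) # xs) (word_inverse xs @ xs)"
    by (rule free_eq_cancel)
  then show ?case
    using Cons free_eq_trans by (fastforce simp: word_inverse_def case_prod_unfold)
qed (simp add: word_inverse_def free_eq_refl)

quotient_type 'a free_group = "('a \<times> bool) list" / free_eq
  by (intro equivpI reflpI sympI transpI) (blast intro: free_eq.intros)+

lemma free_group_exhaust: obtains xs where "g = abs_free_group xs"
  using Quotient3_abs_rep[OF Quotient3_free_group, of g] that[of "rep_free_group g"] by simp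

instantiation free_group :: (type) group_add
begin

lift_definition zero_free_group :: "'a free_group" is "[]" .

lift_definition plus_free_group :: "'a free_group \<Rightarrow> 'a free_group \<Rightarrow> 'a free_group" is "(@)"
  by (meson free_eq_append_left free_eq_append_right free_eq_trans)

lift_definition uminus_free_group :: "'a free_group \<Rightarrow> 'a free_group" is word_inverse
  by (rule free_eq_word_inverse)

definition minus_free_group :: "'a free_group \<Rightarrow> 'a free_group \<Rightarrow> 'a free_group"
  where "minus_free_group g h = g + - h"

instance
proof
  fix g h k :: "'a free_group"
  show "g + h + k = g + (h + k)" by transfer (simp add: free_eq_refl)
  show "0 + g = g" "g + 0 = g" by (transfer, simp add: free_eq_refl)+
  show "- g + g = 0" by transfer (rule free_eq_word_inverse_left)
  show "g + - h = g - h" by (simp add: minus_free_group_def)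
qed

end

lift_definition free_gen :: "'a \<Rightarrow> 'a free_group" is "\<lambda>a. [(a, True)]" .

definition canonical_unitary :: "'a \<Rightarrow> 'a free_group group_cstar"
  where "canonical_unitary a = group_unitary (free_gen a)"

primrec word_eval :: "('a \<Rightarrow> 'b::cstar_algebra) \<Rightarrow> ('a \<times> bool) list \<Rightarrow> 'b"
  where
    "word_eval v [] = 1"
  | "word_eval v (x # xs) = (if snd x then v (fst x) else star (v (fst x))) * word_eval v xs"

lemma word_eval_append: "word_eval v (xs @ ys) = word_eval v xs * word_eval v ys"
  by (induction xs) (simp_all add: mult.assoc)

lemma unitary_mult:
  assumes "unitary p" "unitary (q :: 'b::cstar_algebra)"
  shows "unitary (p * q)"
proof -
  have "star q * star p * (p * q) = star q * (star p * p) * q"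
    "p * q * (star q * star p) = p * (q * star q) * star p" by (simp_all add: mult.assoc)
  with assms show ?thesis by (simp add: unitary_def star_mult)
qed

lemma unitary_star: "unitary p \<Longrightarrow> unitary (star p)"
  by (simp add: unitary_def star_star)

lemma unitary_word_eval:
  assumes "\<And>a. unitary (v a)" shows "unitary (word_eval v xs)"
proof (induction xs)
  case Nil
  show ?case by (simp add: unitary_def)
next
  case (Cons x xs)
  then show ?case using assms[of "fst x"] by (simp add: unitary_mult unitary_star)
qed

lemma word_eval_free_eq:
  assumes "\<And>a. unitary (v a)" "free_eq xs ys"
  shows "word_eval v xs = word_eval v ys"
  using assms(2)
proof (induction rule: free_eq.induct)
  case (free_eq_cancel xs a b ys)
  have "star (v a) * v a = 1" "v a * star (v a) = 1" using assms(1)[of a] by (auto simp: unitary_def)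
  then show ?case by (cases b) (simp_all add: word_eval_append flip: mult.assoc)
qed simp_all

lemma free_group_rep_exists:
  fixes v :: "'a \<Rightarrow> 'b::cstar_algebra"
  assumes v: "\<And>a. unitary (v a)"
  shows "\<exists>U. unitary_rep U \<and> (\<forall>a. U (free_gen a) = v a)"
proof -
  define U where "U g = word_eval v (rep_free_group g)" for g
  have U: "U (abs_free_group xs) = word_eval v xs" for xs
    unfolding U_def
    by (rule word_eval_free_eq[OF v])
      (metis Quotient3_free_group Quotient3_rep_abs free_eq_refl)
  have "U (g + h) = U g * U h" for g h
    by (cases g rule: free_group_exhaust; cases h rule: free_group_exhaust) (simp add: plus_free_group.abs_eq U word_eval_append)
  moreover have "unitary (U g)" for g
    unfolding U_def by (rule unitary_word_eval[OF v])
  moreover have "U (free_gen a) = v a" for a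
    by (simp add: free_gen.abs_eq U)
  ultimately show ?thesis unfolding unitary_rep_def by blast
qed

lemma unitary_rep_free_group_eqI:
  assumes "unitary_rep U" "unitary_rep V" "\<And>a. U (free_gen a) = V (free_gen a)"
  shows "U = V"
proof
  fix g
  have "U (abs_free_group xs) = V (abs_free_group xs)" for xs
  proof (induction xs)
    case Nil
    show ?case
      using unitary_rep_zero[OF assms(1)] unitary_rep_zero[OF assms(2)] by (simp add: zero_free_group.abs_eq)
  next
    case (Cons x xs)
    obtain a b where x: "x = (a, b)" by (cases x)
    have "abs_free_group [x] = (if b then free_gen a else - free_gen a)"
      by (simp add: x free_gen.abs_eq uminus_free_group.abs_eq word_inverse_def)
    then have "U (abs_free_group [x]) = V (abs_free_group [x])"
      using assms by (simp add: unitary_rep_minus)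
    moreover have "abs_free_group (x # xs) = abs_free_group [x] + abs_free_group xs"
      by (simp add: plus_free_group.abs_eq)
    ultimately show ?case using Cons assms by (simp add: unitary_rep_def)
  qed
  then show "U g = V g" by (cases g rule: free_group_exhaust) simp
qed

lemma unitary_rep_star_hom:
  assumes "star_hom h" "unitary_rep U"
  shows "unitary_rep (\<lambda>g. h (U g))"
proof -
  have h: "h (x * y) = h x * h y" "h 1 = 1" "star (h x) = h (star x)" for x y
    using assms(1) by (simp_all add: star_hom_def)
  show ?thesis
    using assms(2) by (simp add: unitary_rep_def unitary_def h flip: h(1))
qed

lemma unitary_canonical_unitary: "unitary (canonical_unitary a)"
  using unitary_rep_group_unitary[where 'a = "'a free_group"]
  by (simp add: canonical_unitary_def unitary_rep_def)

lemma star_hom_free_group_cstar_eqI: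
  fixes h k :: "'a free_group group_cstar \<Rightarrow> 'b::cstar_algebra"
  assumes "star_hom h" "star_hom k" "\<And>a. h (canonical_unitary a) = k (canonical_unitary a)"
  shows "h = k"
proof (rule star_hom_group_cstar_eqI)
  have "(\<lambda>g. h (group_unitary g)) = (\<lambda>g. k (group_unitary g))"
    by (rule unitary_rep_free_group_eqI[OF unitary_rep_star_hom[OF assms(1) unitary_rep_group_unitary]
          unitary_rep_star_hom[OF assms(2) unitary_rep_group_unitary]])
      (use assms(3) in \<open>simp add: canonical_unitary_def\<close>)
  then show "h (group_unitary g) = k (group_unitary g)" for g by (rule fun_cong)
qed (use assms in auto)

theorem free_group_cstar_universal:
  fixes v :: "'a \<Rightarrow> 'b::cstar_algebra"
  assumes "\<And>a. unitary (v a)"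
  shows "\<exists>!h. star_hom h \<and> (\<forall>a. h (canonical_unitary a) = v a)"
proof (rule ex_ex1I)
  obtain U where U: "unitary_rep U" "\<forall>a. U (free_gen a) = v a"
    using free_group_rep_exists[of v] assms by blast
  obtain h where "star_hom h" "\<forall>g. h (group_unitary g) = U g"
    using group_cstar_extension_exists[OF U(1)] by blast
  with U show "\<exists>h. star_hom h \<and> (\<forall>a. h (canonical_unitary a) = v a)"
    by (auto simp: canonical_unitary_def)
next
  show "h = k"
    if "star_hom h \<and> (\<forall>a. h (canonical_unitary a) = v a)"
      "star_hom k \<and> (\<forall>a. k (canonical_unitary a) = v a)" for h k
    using that by (intro star_hom_free_group_cstar_eqI) simp_all
qed


subsection \<open>The shift\<close>

definition cstar_shift :: "int free_group group_cstar \<Rightarrow> int free_group group_cstar"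
  where "cstar_shift =
    (THE \<alpha>. star_automorphism \<alpha> \<and> (\<forall>i. \<alpha> (canonical_unitary i) = canonical_unitary (i + 1)))"

theorem cstar_shift_exists_unique:
  "\<exists>!\<alpha>. star_automorphism \<alpha> \<and> (\<forall>i::int. \<alpha> (canonical_unitary i) = canonical_unitary (i + 1))"
proof (rule ex_ex1I)
  obtain h where h: "star_hom h" "\<And>i::int. h (canonical_unitary i) = canonical_unitary (i + 1)"
    using ex1_implies_ex[OF free_group_cstar_universal[of "\<lambda>i::int. canonical_unitary (i + 1)",
          OF unitary_canonical_unitary]] by auto
  obtain k where k: "star_hom k" "\<And>i::int. k (canonical_unitary i) = canonical_unitary (i - 1)"
    using ex1_implies_ex[OF free_group_cstar_universal[of "\<lambda>i::int. canonical_unitary (i - 1)",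
          OF unitary_canonical_unitary]] by auto
  have comp: "star_hom (p \<circ> q)" if "star_hom p" "star_hom q"
    for p q :: "int free_group group_cstar \<Rightarrow> int free_group group_cstar"
    using that by (simp add: star_hom_def)
  have id: "star_hom (id :: int free_group group_cstar \<Rightarrow> _)" by (simp add: star_hom_def)
  have "h \<circ> k = id" "k \<circ> h = id"
    using h k by (auto intro!: star_hom_free_group_cstar_eqI comp id)
  then have "bij h" using o_bij by blast
  with h show "\<exists>\<alpha>. star_automorphism \<alpha> \<and> (\<forall>i::int. \<alpha> (canonical_unitary i) = canonical_unitary (i + 1))"
    unfolding star_automorphism_def by blast
next
  show "\<alpha> = \<beta>"
    if "star_automorphism \<alpha> \<and> (\<forall>i::int. \<alpha> (canonical_unitary i) = canonical_unitary (i + 1))"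
      "star_automorphism \<beta> \<and> (\<forall>i::int. \<beta> (canonical_unitary i) = canonical_unitary (i + 1))" for \<alpha> \<beta>
    using that by (intro star_hom_free_group_cstar_eqI) (simp_all add: star_automorphism_def)
qed

lemma star_automorphism_cstar_shift: "star_automorphism cstar_shift"
  and cstar_shift_canonical_unitary: "cstar_shift (canonical_unitary i) = canonical_unitary (i + 1)"
  by (rule theI'[OF cstar_shift_exists_unique, folded cstar_shift_def, THEN conjunct1],
      rule theI'[OF cstar_shift_exists_unique, folded cstar_shift_def, THEN conjunct2, THEN spec])


subsection \<open>The induced homeomorphism of the state space\<close>

lemma homeomorphic_map_state_space:
  assumes "star_automorphism h"
  shows "homeomorphic_map weak_star_state_space weak_star_state_space (\<lambda>\<sigma>. \<sigma> \<circ> h)"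
proof -
  have h: "star_hom h" "bij h" using assms by (auto simp: star_automorphism_def)
  let ?k = "inv h"
  have hk: "h (?k x) = x" "?k (h x) = x" for x
    using h(2) by (simp_all add: bij_is_surj surj_f_inv_f bij_is_inj)
  have k: "star_hom ?k"
    unfolding star_hom_def
    by (intro conjI allI; rule injD[OF bij_is_inj[OF h(2)]])
      (use h(1) in \<open>simp_all add: hk star_hom_def\<close>)
  have cont: "continuous_map weak_star_state_space weak_star_state_space (\<lambda>\<sigma>. \<sigma> \<circ> p)"
    if p: "star_hom p" for p :: "'a \<Rightarrow> 'a"
  proof -
    have "continuous_map (product_topology (\<lambda>_. euclidean) UNIV) (product_topology (\<lambda>_. euclidean) UNIV)
        (\<lambda>\<sigma> :: 'a \<Rightarrow> complex. \<sigma> \<circ> p)"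
      by (auto simp: continuous_map_componentwise_UNIV intro: continuous_map_product_projection)
    moreover have "\<sigma> \<circ> p \<in> state_space" if "\<sigma> \<in> state_space" for \<sigma>
    proof -
      have "p (star x * x) = star (p x) * p x" for x using p by (simp add: star_hom_def)
      then show ?thesis using that p by (simp add: state_space_def star_hom_def)
    qed
    ultimately show ?thesis
      unfolding weak_star_state_space_def
      by (auto simp: continuous_map_in_subtopology intro: continuous_map_from_subtopology)
  qed
  have "homeomorphic_maps weak_star_state_space weak_star_state_space (\<lambda>\<sigma>. \<sigma> \<circ> h) (\<lambda>\<sigma>. \<sigma> \<circ> ?k)"
    unfolding homeomorphic_maps_def using cont[OF h(1)] cont[OF k] hk by (auto simp: o_def)
  then show ?thesis by (rule homeomorphic_maps_imp_map)
qed


section \<open>Topological entropy\<close>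

definition finite_open_covers :: "'x topology \<Rightarrow> 'x set set set"
  where "finite_open_covers X = {\<U>. finite \<U> \<and> (\<forall>U\<in>\<U>. openin X U) \<and> \<Union>\<U> = topspace X}"

definition min_subcover_card :: "'x topology \<Rightarrow> 'x set set \<Rightarrow> nat"
  where "min_subcover_card X \<U> =
    (LEAST n. \<exists>\<V>\<subseteq>\<U>. finite \<V> \<and> \<Union>\<V> = topspace X \<and> card \<V> = n)"

definition cover_join :: "'x set set \<Rightarrow> 'x set set \<Rightarrow> 'x set set"
  where "cover_join \<U> \<V> = {U \<inter> V | U V. U \<in> \<U> \<and> V \<in> \<V>}"

definition cover_preimage :: "'x topology \<Rightarrow> ('x \<Rightarrow> 'x) \<Rightarrow> 'x set set \<Rightarrow> 'x set set"
  where "cover_preimage X T \<U> = (\<lambda>U. {x \<in> topspace X. T x \<in> U}) ` \<U>"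

text \<open>\<open>iterated_join X T \<U> n\<close> is \<open>\<U> \<or> T\<^sup>-\<^sup>1 \<U> \<or> \<dots> \<or> T\<^sup>-\<^sup>(\<^sup>n\<^sup>-\<^sup>1\<^sup>) \<U>\<close>; the trivial cover is neutral for joins.\<close>

primrec iterated_join :: "'x topology \<Rightarrow> ('x \<Rightarrow> 'x) \<Rightarrow> 'x set set \<Rightarrow> nat \<Rightarrow> 'x set set"
  where
    "iterated_join X T \<U> 0 = {topspace X}"
  | "iterated_join X T \<U> (Suc n) = cover_join (iterated_join X T \<U> n) (cover_preimage X (T ^^ n) \<U>)"

definition cover_entropy :: "'x topology \<Rightarrow> ('x \<Rightarrow> 'x) \<Rightarrow> 'x set set \<Rightarrow> real"
  where "cover_entropy X T \<U> =
    lim (\<lambda>n. ln (real (min_subcover_card X (iterated_join X T \<U> n))) / real n)"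

definition topological_entropy :: "'x topology \<Rightarrow> ('x \<Rightarrow> 'x) \<Rightarrow> ereal"
  where "topological_entropy X T = (SUP \<U>\<in>finite_open_covers X. ereal (cover_entropy X T \<U>))"

end

(* A function from the integers to the unit circle prescribes a character, in particular a state, of
   the full C*-algebra of the free group, and cstar_shift shifts the prescribed function.  For a finite
   set D of k points on the circle, cover the state space by the k sets of states \<sigma> whose value at the
   0th canonical unitary avoids all points of D but one.  The characters with values in D show that the
   n-fold join of this cover has no subcover with fewer than k^n elements, so its entropy is ln k. *)

theory Submission
  imports Defs
begin

lemma finite_cover_join: "finite \<U> \<Longrightarrow> finite \<V> \<Longrightarrow> finite (cover_join \<U> \<V>)"
  using finite_image_set2[of "\<lambda>U. U \<in> \<U>" "\<lambda>V. V \<in> \<V>" "(\<inter>)"] by (simp add: cover_join_def)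

lemma card_cover_join_le:
  assumes "finite \<U>" "finite \<V>"
  shows "card (cover_join \<U> \<V>) \<le> card \<U> * card \<V>"
proof -
  have "cover_join \<U> \<V> = (\<lambda>(U, V). U \<inter> V) ` (\<U> \<times> \<V>)"
    by (auto simp: cover_join_def)
  with assms show ?thesis
    by (metis card_cartesian_product card_image_le finite_cartesian_product)
qed

lemma Union_cover_join: "\<Union>(cover_join \<U> \<V>) = \<Union>\<U> \<inter> \<Union>\<V>"
  by (auto simp: cover_join_def)

lemma Union_cover_preimage:
  assumes "\<Union>\<U> = topspace X" "T ` topspace X \<subseteq> topspace X"
  shows "\<Union>(cover_preimage X T \<U>) = topspace X"
proof -
  have "\<Union>(cover_preimage X T \<U>) = {x \<in> topspace X. T x \<in> \<Union>\<U>}"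
    by (auto simp: cover_preimage_def)
  with assms show ?thesis by auto
qed

lemma funpow_image_subset: "T ` S \<subseteq> S \<Longrightarrow> (T ^^ n) ` S \<subseteq> S"
  by (induction n) auto

lemma finite_iterated_join: "finite \<U> \<Longrightarrow> finite (iterated_join X T \<U> n)"
  by (induction n) (simp_all add: finite_cover_join cover_preimage_def)

lemma card_iterated_join_le:
  assumes "finite \<U>"
  shows "card (iterated_join X T \<U> n) \<le> card \<U> ^ n"
proof (induction n)
  case (Suc n)
  have "card (iterated_join X T \<U> (Suc n))
      \<le> card (iterated_join X T \<U> n) * card (cover_preimage X (T ^^ n) \<U>)"
    using assms by (simp add: card_cover_join_le finite_iterated_join cover_preimage_def)
  also have "\<dots> \<le> card \<U> ^ n * card \<U>"
    using Suc assms by (intro mult_mono) (simp_all add: cover_preimage_def card_image_le)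
  finally show ?case by (simp add: mult.commute)
qed simp

lemma Union_iterated_join:
  assumes "\<Union>\<U> = topspace X" "T ` topspace X \<subseteq> topspace X"
  shows "\<Union>(iterated_join X T \<U> n) = topspace X"
  using assms
  by (induction n) (simp_all add: Union_cover_join Union_cover_preimage funpow_image_subset)

text \<open>Extracts the i-th factor of the intersection that makes up a member of the join, so that
  the lower bound can compare points one time step at a time.\<close>

lemma iterated_joinD:
  assumes "W \<in> iterated_join X T \<U> n" "i < n"
  obtains U where "U \<in> \<U>" "W \<subseteq> {x. (T ^^ i) x \<in> U}"
  using assms
proof (induction n arbitrary: W thesis)
  case (Suc n)
  then obtain V U where W: "W = V \<inter> {x \<in> topspace X. (T ^^ n) x \<in> U}" "V \<in> iterated_join X T \<U> n" "U \<in> \<U>"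
    by (auto simp: cover_join_def cover_preimage_def)
  show ?case
  proof (cases "i = n")
    case True
    then show ?thesis using Suc.prems(1)[of U] W by auto
  next
    case False
    then have "i < n" using Suc.prems(3) by simp
    then obtain U' where "U' \<in> \<U>" "V \<subseteq> {x. (T ^^ i) x \<in> U'}"
      using Suc.IH[OF _ W(2)] by blast
    then show ?thesis using Suc.prems(1)[of U'] W(1) by blast
  qed
qed simp

text \<open>The inequality \<open>card \<V> \<le> n\<close> suffices for the witness, since the
  lower bound applies to \<open>\<V>\<close> itself and turns it into equality.\<close>

lemma min_subcover_card_eqI:
  assumes "\<V> \<subseteq> \<U>" "finite \<V>" "\<Union>\<V> = topspace X" "card \<V> \<le> n"
    and lower: "\<And>\<W>. \<W> \<subseteq> \<U> \<Longrightarrow> finite \<W> \<Longrightarrow> \<Union>\<W> = topspace X \<Longrightarrow> n \<le> card \<W>"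
  shows "min_subcover_card X \<U> = n"
  unfolding min_subcover_card_def
proof (rule Least_equality)
  have "card \<V> = n" using lower[OF assms(1-3)] assms(4) by simp
  with assms(1-3) show "\<exists>\<V>\<subseteq>\<U>. finite \<V> \<and> \<Union>\<V> = topspace X \<and> card \<V> = n" by auto
qed (use lower in auto)

text \<open>A point with \<open>f x\<close> in \<open>D\<close> lies only in the member indexed by
  \<open>f x\<close>, while a point with \<open>f x\<close> outside \<open>D\<close> lies in every
  member. Removing the other points of \<open>D\<close>, instead of choosing neighbourhoods of
  \<open>d\<close>, lets the members overlap off \<open>D\<close> and so cover the space.\<close>

definition separating_cover :: "'x topology \<Rightarrow> ('x \<Rightarrow> 'b) \<Rightarrow> 'b set \<Rightarrow> 'x set set"
  where "separating_cover X f D = (\<lambda>d. {x \<in> topspace X. f x \<notin> D - {d}}) ` D"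

lemma Union_separating_cover:
  "D \<noteq> {} \<Longrightarrow> \<Union>(separating_cover X f D) = topspace X"
  by (auto simp: separating_cover_def)

text \<open>Finite sets are closed in a T1 space, so each member is the preimage of the open set
  \<open>- (D - {d})\<close>.\<close>

lemma separating_cover_in_finite_open_covers:
  fixes f :: "'x \<Rightarrow> 'b::t1_space"
  assumes "continuous_map X euclidean f" "finite D" "D \<noteq> {}"
  shows "separating_cover X f D \<in> finite_open_covers X"
proof -
  have "openin X {x \<in> topspace X. f x \<in> - (D - {d})}" for d
    using assms by (intro openin_continuous_map_preimage[OF assms(1)])
      (simp add: finite_imp_closed open_Compl del: Compl_Diff_eq)
  then have "\<forall>U\<in>separating_cover X f D. openin X U"
    by (simp only: separating_cover_def ball_simps Compl_iff) simp
  moreover have "finite (separating_cover X f D)"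
    using assms by (simp add: separating_cover_def)
  ultimately show ?thesis
    using assms by (simp add: finite_open_covers_def Union_separating_cover)
qed

text \<open>The join has at most \<open>card D ^ n\<close> members. Conversely, each word of length
  \<open>n\<close> over \<open>D\<close> is the itinerary of some point, and no member of the join
  contains points with two different itineraries, so a subcover needs one member per word.\<close>

lemma min_subcover_card_separating_cover:
  assumes T: "T ` topspace X \<subseteq> topspace X" and D: "finite D" "D \<noteq> {}"
    and realised: "\<And>w. range w \<subseteq> D \<Longrightarrow> \<exists>x\<in>topspace X. \<forall>i. f ((T ^^ i) x) = w i"
  shows "min_subcover_card X (iterated_join X T (separating_cover X f D) n) = card D ^ n"
proof (rule min_subcover_card_eqI[OF subset_refl])
  let ?U = "separating_cover X f D"
  have fin: "finite ?U" using D by (simp add: separating_cover_def)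
  show "finite (iterated_join X T ?U n)" by (rule finite_iterated_join[OF fin])
  show "\<Union>(iterated_join X T ?U n) = topspace X"
    by (rule Union_iterated_join[OF Union_separating_cover[OF D(2)] T])
  have "card ?U \<le> card D" using D by (simp add: separating_cover_def card_image_le)
  then show "card (iterated_join X T ?U n) \<le> card D ^ n"
    using card_iterated_join_le[OF fin, of X T n] by (meson order_trans power_mono zero_le)
  fix \<W> assume \<W>: "\<W> \<subseteq> iterated_join X T ?U n" "finite \<W>" "\<Union>\<W> = topspace X"
  let ?P = "{..<n} \<rightarrow>\<^sub>E D"
  obtain d0 where d0: "d0 \<in> D" using D by blast
  have "\<exists>W\<in>\<W>. \<exists>x\<in>W. \<forall>i<n. f ((T ^^ i) x) = w i" if w: "w \<in> ?P" for w
  proof -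
    \<comment> \<open>A word in \<open>?P\<close> is \<open>undefined\<close> from \<open>n\<close>
      on; padding it with \<open>d0\<close> gives an infinite sequence in \<open>D\<close>, as
      \<open>realised\<close> demands.\<close>
    have "range (\<lambda>i. if i < n then w i else d0) \<subseteq> D" using w d0 by auto
    from realised[OF this] show ?thesis using \<W>(3) by (metis UnionE)
  qed
  then obtain W x where Wx: "\<And>w. w \<in> ?P \<Longrightarrow> W w \<in> \<W>" "\<And>w. w \<in> ?P \<Longrightarrow> x w \<in> W w"
    "\<And>w i. w \<in> ?P \<Longrightarrow> i < n \<Longrightarrow> f ((T ^^ i) (x w)) = w i"
    by metis
  have "inj_on W ?P"
  proof (rule inj_onI)
    fix v w assume vw: "v \<in> ?P" "w \<in> ?P" "W v = W w"
    show "v = w"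
    proof (rule PiE_ext[OF vw(1,2)])
      fix i assume i: "i \<in> {..<n}"
      then obtain U where "U \<in> ?U" "W v \<subseteq> {x. (T ^^ i) x \<in> U}"
        using iterated_joinD \<W>(1) Wx(1)[OF vw(1)] by (metis lessThan_iff subsetD)
      \<comment> \<open>A single \<open>d\<close> serves the whole of \<open>W v\<close>, which
        contains both \<open>x v\<close> and \<open>x w\<close>; hence \<open>v i\<close> and
        \<open>w i\<close> both equal \<open>d\<close>.\<close>
      then obtain d where "\<forall>x\<in>W v. f ((T ^^ i) x) \<notin> D - {d}"
        unfolding separating_cover_def by fast
      then have "v i \<notin> D - {d}" "w i \<notin> D - {d}"
        using Wx(2,3)[OF vw(1)] Wx(2,3)[OF vw(2)] vw(3) i by (metis lessThan_iff)+
      moreover have "v i \<in> D" "w i \<in> D" using vw i by auto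
      ultimately show "v i = w i" by simp
    qed
  qed
  then have "card ?P \<le> card \<W>" using Wx(1) \<W>(2) by (intro card_inj_on_le[of W]) auto
  then show "card D ^ n \<le> card \<W>" by (simp add: card_funcsetE)
qed

lemma cover_entropy_separating_cover:
  assumes "T ` topspace X \<subseteq> topspace X" "finite D" "D \<noteq> {}"
    and "\<And>w. range w \<subseteq> D \<Longrightarrow> \<exists>x\<in>topspace X. \<forall>i. f ((T ^^ i) x) = w i"
  shows "cover_entropy X T (separating_cover X f D) = ln (real (card D))"
proof -
  have pos: "card D > 0" using assms(2,3) by (simp add: card_gt_0_iff)
  \<comment> \<open>The quotient is constant for positive \<open>n\<close>; at \<open>n = 0\<close>
    it is 0 by division by zero, which the limit ignores.\<close>
  have "(\<lambda>n. ln (real (card D ^ n)) / real n) \<longlonglongrightarrow> ln (real (card D))"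
    by (rule tendsto_eventually, rule eventually_mono[OF eventually_gt_at_top[of 0]])
      (use pos in \<open>simp add: ln_realpow\<close>)
  moreover have "min_subcover_card X (iterated_join X T (separating_cover X f D) n) = card D ^ n" for n
    by (rule min_subcover_card_separating_cover) (use assms in auto)
  ultimately show ?thesis by (simp only: cover_entropy_def limI)
qed

text \<open>Positivity holds because \<phi> sends \<open>star x * x\<close> to the squared modulus
  of \<open>\<phi> x\<close>.\<close>

lemma star_hom_complex_in_state_space:
  assumes "star_hom (\<phi> :: 'a::cstar_algebra \<Rightarrow> complex)"
  shows "\<phi> \<in> state_space"
proof -
  have "\<phi> (star x * x) = complex_of_real ((cmod (\<phi> x))\<^sup>2)" for x
    using assms by (simp only: star_hom_def star_complex_def mult.commute complex_norm_square)
  then have "\<phi> (star x * x) \<in> \<real>\<^sub>\<ge>\<^sub>0" for x by (simp only: nonneg_Reals_of_real_iff zero_le_power2)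
  then show ?thesis using assms by (simp add: state_space_def star_hom_def scaleC_complex_def)
qed

lemma unitary_complex_iff: "unitary (z :: complex) \<longleftrightarrow> cmod z = 1"
proof -
  have "unitary z \<longleftrightarrow> complex_of_real ((cmod z)\<^sup>2) = complex_of_real 1"
    by (simp only: unitary_def star_complex_def complex_norm_square mult.commute[of "cnj z"]) simp
  also have "\<dots> \<longleftrightarrow> cmod z = 1"
    by (simp only: of_real_eq_iff power2_eq_1_iff) (use norm_ge_zero[of z] in linarith)
  finally show ?thesis .
qed

text \<open>Points of the circle are the unitaries of the C*-algebra of complex numbers, so the
  universal property extends any choice of them to a character.\<close>

lemma exists_character_free_group_cstar:
  fixes v :: "'a \<Rightarrow> complex"
  assumes "\<And>a. cmod (v a) = 1"
  shows "\<exists>\<phi> \<in> state_space. \<forall>a. \<phi> (canonical_unitary a) = v a"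
proof -
  have "unitary (v a)" for a using assms by (simp add: unitary_complex_iff)
  then obtain \<phi> where "star_hom \<phi>" "\<forall>a. \<phi> (canonical_unitary a) = v a"
    using ex1_implies_ex[OF free_group_cstar_universal[of v]] by blast
  then show ?thesis using star_hom_complex_in_state_space by blast
qed

lemma topspace_weak_star_state_space [simp]: "topspace weak_star_state_space = state_space"
  by (simp add: weak_star_state_space_def)

text \<open>Evaluation at \<open>x\<close> is a coordinate projection of the product topology,
  restricted to the states.\<close>

lemma continuous_map_weak_star_eval:
  "continuous_map weak_star_state_space euclidean (\<lambda>\<sigma>. \<sigma> x)"
  unfolding weak_star_state_space_def
  by (intro continuous_map_from_subtopology continuous_map_product_projection) simp

text \<open>The outermost application moves the index from \<open>i\<close> to \<open>i + 1\<close>,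
  so the induction hypothesis is used at \<open>i + 1\<close> and \<open>i\<close> must be
  arbitrary.\<close>

lemma funpow_shift_canonical_unitary:
  "((\<lambda>\<sigma>. \<sigma> \<circ> cstar_shift) ^^ n) \<sigma> (canonical_unitary i) = \<sigma> (canonical_unitary (i + int n))"
  by (induction n arbitrary: i) (simp_all add: cstar_shift_canonical_unitary add.assoc)

lemma ln_le_topological_entropy_shift:
  assumes "k > 0"
  shows "ereal (ln (real k)) \<le> topological_entropy weak_star_state_space
    (\<lambda>\<sigma> :: int free_group group_cstar \<Rightarrow> complex. \<sigma> \<circ> cstar_shift)"
proof -
  let ?X = "weak_star_state_space :: (int free_group group_cstar \<Rightarrow> complex) topology"
  let ?T = "\<lambda>\<sigma> :: int free_group group_cstar \<Rightarrow> complex. \<sigma> \<circ> cstar_shift"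
  let ?f = "\<lambda>\<sigma> :: int free_group group_cstar \<Rightarrow> complex. \<sigma> (canonical_unitary 0)"
  \<comment> \<open>The \<open>k\<close>-th roots of unity serve as the \<open>k\<close> points on
    the circle.\<close>
  define D where "D = {z::complex. z ^ k = 1}"
  have D: "finite D" "card D = k"
    unfolding D_def using assms by (auto intro: finite_roots_unity card_roots_unity_eq)
  then have D0: "D \<noteq> {}" using assms by auto
  have norm_D: "cmod z = 1" if "z \<in> D" for z
    using that assms power_eq_1_iff[of z k] by (simp add: D_def)
  have T: "?T ` topspace ?X \<subseteq> topspace ?X"
    using homeomorphic_imp_surjective_map[OF homeomorphic_map_state_space[OF star_automorphism_cstar_shift]]
    by (rule equalityD1)
  have realised: "\<exists>\<phi>\<in>topspace ?X. \<forall>i. ?f ((?T ^^ i) \<phi>) = w i" if "range w \<subseteq> D" for w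
  proof -
    \<comment> \<open>The orbit of \<phi> is read at the 0th unitary, so only the indices
      \<open>int i\<close> matter; \<open>nat\<close> gives all negative indices the value
      \<open>w 0\<close>.\<close>
    have "cmod (w (nat a)) = 1" for a using that norm_D by blast
    from exists_character_free_group_cstar[of "\<lambda>a. w (nat a)", OF this]
    obtain \<phi> :: "int free_group group_cstar \<Rightarrow> complex"
      where \<phi>: "\<phi> \<in> state_space" "\<And>a. \<phi> (canonical_unitary a) = w (nat a)" by blast
    have "?f ((?T ^^ i) \<phi>) = w i" for i by (simp only: funpow_shift_canonical_unitary \<phi>(2)) simp
    with \<phi>(1) show ?thesis by (intro bexI[of _ \<phi>]) simp_all
  qed
  have "cover_entropy ?X ?T (separating_cover ?X ?f D) = ln (real (card D))"
    by (rule cover_entropy_separating_cover[OF T D(1) D0]) (rule realised)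
  moreover have "separating_cover ?X ?f D \<in> finite_open_covers ?X"
    by (rule separating_cover_in_finite_open_covers[OF continuous_map_weak_star_eval D(1) D0])
  ultimately show ?thesis
    using SUP_upper[of _ _ "\<lambda>\<U>. ereal (cover_entropy ?X ?T \<U>)"]
    unfolding topological_entropy_def D(2) by fastforce
qed

theorem proposition2p4:
  "topological_entropy weak_star_state_space
    (\<lambda>\<sigma> :: int free_group group_cstar \<Rightarrow> complex. \<sigma> \<circ> cstar_shift) = \<infinity>"
proof (rule ereal_top)
  fix B :: real
  \<comment> \<open>The least natural number with \<open>exp B \<le> k\<close>, so that
    \<open>ln k\<close> is at least \<open>B\<close>.\<close>
  define k where "k = nat \<lceil>exp B\<rceil>"
  have "exp B \<le> real k" unfolding k_def by linarith
  then have "0 < real k" by (rule less_le_trans[OF exp_gt_zero])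
  with \<open>exp B \<le> real k\<close> have k: "B \<le> ln (real k)" "k > 0" by (simp_all add: ln_ge_iff)
  from k(1) have "ereal B \<le> ereal (ln (real k))" by simp
  also note ln_le_topological_entropy_shift[OF k(2)]
  finally show "ereal B \<le> topological_entropy weak_star_state_space
    (\<lambda>\<sigma> :: int free_group group_cstar \<Rightarrow> complex. \<sigma> \<circ> cstar_shift)" .
qed

end
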